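(* Let $W$ be a finite Coxeter group of type $A_n$ ($n\ge 2$), $B_n$ ($n\ge2$) or $D_n$ ($n\ge 4$), with bipartite Coxeter element $c=c_-c_+$, Coxeter number $h$ and Coxeter plane $P$. (a) In type $A_n$, the orthogonal projection to $P$ of the orbit $\{e_1,\dots,e_{n+1}\}$ is the vertex set of a regular $(n+1)$-gon (that is, a regular $h$-gon) centered at the origin, the cyclic order of the vertices being given by the $(n+1)$-cycle $c$. (b) In type $B_n$, the orthogonal projection to $P$ of the orbit $\{\pm e_1,\dots,\pm e_n\}$ is the vertex set of a regular $2n$-gon (that is, a regular $h$-gon) centered at the origin. (c) In type $D_n$, consider the orbit $\{\pm e_1,\dots,\pm e_n\}$: the elements $e_n$ and $-e_n$ both project orthogonally to the origin of $P$, and the other $2n-2$ elements project to the vertices of a regular $h$-gon in $P$ centered at the origin, where $h=2n-2$.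
   Context: $(W,S)$ is represented as a real reflection group on a Euclidean space $V$ so that only the origin is fixed by $W$. Type $A_n$ is $S_{n+1}$ permuting coordinates of $\mathbb{R}^{n+1}$ modulo the line spanned by $(1,\dots,1)$ (equivalently, project orthogonally to the sum-zero hyperplane), with simple reflections $s_i=(i\ i{+}1)$, $i\in[n]$. Type $B_n$ acts on $\mathbb{R}^n$ with simple reflections $s_i$ transposing $e_i,e_{i+1}$ for $i\le n-1$ and $s_n$ the reflection orthogonal to $e_n$. Type $D_n$ acts on $\mathbb{R}^n$ with $s_i$ transposing $e_i,e_{i+1}$ for $i\le n-1$ and $s_n$ transposing $e_{n-1}$ and $-e_n$. The bipartition $S=S_+\sqcup S_-$ of the Coxeter diagram is $S_+=\{s_1,s_3,\dots\}$, $S_-=\{s_2,s_4,\dots\}$, except that in type $D_n$ the reflection $s_n$ is placed in the same part as $s_{n-1}$. Put $c_\pm=\prod_{s\in S_\pm}s$ and $c=c_-c_+$; $h$ is the order of $c$. Coxeter plane. Let $\alpha_s$ ($s\in S$) be the unit simple roots (normals to the reflecting hyperplanes of the simple reflections, with pairwise nonpositive inner products), let $(c_s)_{s\in S}$ be a positive eigenvector of the Gram matrix $(\langle\alpha_s,\alpha_{s'}\rangle)$ for its smallest eigenvalue, and let $(\omega_s)$ be the basis of $V$ dual to $(\alpha_s)$. Then $P=\mathrm{span}\big(\sum_{s\in S_+}c_s\omega_s,\ \sum_{s\in S_-}c_s\omega_s\big)$. The group $\langle c_+,c_-\rangle$ preserves $P$ and acts on it as a dihedral reflection group of order $2h$.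 *)

theory Defs
  imports "HOL-Analysis.Analysis" "HOL-Combinatorics.Orbits"
begin

text \<open>
  Coordinate vectors \<open>e 1, \<dots>, e m\<close> are an enumeration of the standard basis of a Euclidean space
  of dimension \<open>m\<close> (for instance \<open>real ^ 'n\<close> with \<open>m = CARD('n)\<close>); group elements are linear
  maps on that space, and products in the group are compositions.
\<close>

definition std_basis :: "(nat \<Rightarrow> 'a::euclidean_space) \<Rightarrow> nat \<Rightarrow> bool" where
  "std_basis e m \<longleftrightarrow> bij_betw e {1..m} Basis"

definition lin_map :: "(nat \<Rightarrow> 'a::euclidean_space) \<Rightarrow> nat \<Rightarrow> (nat \<Rightarrow> 'a) \<Rightarrow> 'a \<Rightarrow> 'a" where
  "lin_map e m f x = (\<Sum>i = 1..m. (x \<bullet> e i) *\<^sub>R f i)"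

lemma lin_map_basis:
  assumes "std_basis e m" "i \<in> {1..m}"
  shows "lin_map e m f (e i) = f i"
proof -
  have "e i \<bullet> e j = (if j = i then 1 else 0)" if j: "j \<in> {1..m}" for j
  proof -
    have "e i \<in> Basis" "e j \<in> Basis" "e i = e j \<longleftrightarrow> i = j"
      using assms j unfolding std_basis_def by (auto dest: bij_betwE bij_betw_imp_inj_on simp: inj_on_eq_iff)
    then show ?thesis by (simp add: inner_Basis eq_commute)
  qed
  then have "lin_map e m f (e i) = (\<Sum>j = 1..m. if j = i then f j else 0)"
    unfolding lin_map_def by (intro sum.cong refl) simp
  then show ?thesis using assms(2) by simp
qed

lemma linear_lin_map: "linear (lin_map e m f)"
  unfolding lin_map_def
  by (intro linearI)
    (simp_all add: inner_add_left scaleR_add_left sum.distrib scaleR_sum_right)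

text \<open>In type \<open>A n\<close> the coordinates are \<open>e 1, \<dots>, e (n + 1)\<close>.\<close>

definition simple_refl_A :: "(nat \<Rightarrow> 'a::euclidean_space) \<Rightarrow> nat \<Rightarrow> nat \<Rightarrow> 'a \<Rightarrow> 'a" where
  "simple_refl_A e n i =
     lin_map e (n + 1) (\<lambda>j. e (Transposition.transpose i (i + 1) j))"

definition simple_refl_B :: "(nat \<Rightarrow> 'a::euclidean_space) \<Rightarrow> nat \<Rightarrow> nat \<Rightarrow> 'a \<Rightarrow> 'a" where
  "simple_refl_B e n i =
     (if i < n then lin_map e n (\<lambda>j. e (Transposition.transpose i (i + 1) j))
      else lin_map e n (\<lambda>j. if j = n then - e n else e j))"

definition simple_refl_D :: "(nat \<Rightarrow> 'a::euclidean_space) \<Rightarrow> nat \<Rightarrow> nat \<Rightarrow> 'a \<Rightarrow> 'a" where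
  "simple_refl_D e n i =
     (if i < n then lin_map e n (\<lambda>j. e (Transposition.transpose i (i + 1) j))
      else lin_map e n (\<lambda>j. if j = n - 1 then - e n else if j = n then - e (n - 1) else e j))"

text \<open>The space \<open>V\<close> on which the group acts essentially: the sum-zero hyperplane in type \<open>A n\<close>,
  the whole space in types \<open>B n\<close> and \<open>D n\<close>.\<close>

definition sum_zero :: "(nat \<Rightarrow> 'a::euclidean_space) \<Rightarrow> nat \<Rightarrow> 'a set" where
  "sum_zero e n = {x. (\<Sum>i = 1..n + 1. x \<bullet> e i) = 0}"

text \<open>The simple reflections are involutions, so closure under multiplication by them gives the
  generated group.\<close>

inductive_set refl_group :: "(nat \<Rightarrow> 'a \<Rightarrow> 'a) \<Rightarrow> nat \<Rightarrow> ('a \<Rightarrow> 'a) set"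
  for s :: "nat \<Rightarrow> 'a \<Rightarrow> 'a" and n :: nat where
  id: "id \<in> refl_group s n"
| step: "w \<in> refl_group s n \<Longrightarrow> i \<in> {1..n} \<Longrightarrow> s i \<circ> w \<in> refl_group s n"

definition group_orbit :: "(nat \<Rightarrow> 'a \<Rightarrow> 'a) \<Rightarrow> nat \<Rightarrow> 'a \<Rightarrow> 'a set" where
  "group_orbit s n v = {w v |w. w \<in> refl_group s n}"

text \<open>The part \<open>S\<^sub>+\<close> of the bipartition, as a set of indices; \<open>S\<^sub>-\<close> is its complement in \<open>{1..n}\<close>.\<close>

definition plus_AB :: "nat \<Rightarrow> nat set" where
  "plus_AB n = {i \<in> {1..n}. odd i}"

definition plus_D :: "nat \<Rightarrow> nat set" where
  "plus_D n = {i \<in> {1..n - 1}. odd i} \<union> (if odd (n - 1) then {n} else {})"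

text \<open>Product of the \<open>s i\<close>, \<open>i \<in> J\<close>, in increasing order of \<open>i\<close>. It is only used where these
  reflections commute, so the order is immaterial.\<close>

definition refl_prod :: "(nat \<Rightarrow> 'a \<Rightarrow> 'a) \<Rightarrow> nat set \<Rightarrow> 'a \<Rightarrow> 'a" where
  "refl_prod s J = foldr (\<lambda>i w. s i \<circ> w) (sorted_list_of_set J) id"

definition coxeter_elt :: "(nat \<Rightarrow> 'a \<Rightarrow> 'a) \<Rightarrow> nat \<Rightarrow> nat set \<Rightarrow> 'a \<Rightarrow> 'a" where
  "coxeter_elt s n J = refl_prod s ({1..n} - J) \<circ> refl_prod s J"

definition coxeter_number :: "(nat \<Rightarrow> 'a \<Rightarrow> 'a) \<Rightarrow> nat \<Rightarrow> nat set \<Rightarrow> nat" where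
  "coxeter_number s n J = (LEAST m. m > 0 \<and> (coxeter_elt s n J ^^ m) = id)"

text \<open>Unit normals in \<open>V\<close> to the reflecting hyperplanes, with pairwise nonpositive inner products.
  For an irreducible group this leaves only a common sign free, and the plane defined below does
  not depend on it.\<close>

definition unit_simple_roots ::
    "'a::euclidean_space set \<Rightarrow> nat \<Rightarrow> (nat \<Rightarrow> 'a \<Rightarrow> 'a) \<Rightarrow> (nat \<Rightarrow> 'a) \<Rightarrow> bool" where
  "unit_simple_roots V n s \<alpha> \<longleftrightarrow>
     (\<forall>i\<in>{1..n}. \<alpha> i \<in> V \<and> norm (\<alpha> i) = 1 \<and> {x \<in> V. s i x = x} = {x \<in> V. \<alpha> i \<bullet> x = 0}) \<and>
     (\<forall>i\<in>{1..n}. \<forall>j\<in>{1..n}. i \<noteq> j \<longrightarrow> \<alpha> i \<bullet> \<alpha> j \<le> 0)"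

definition gram_eigenvector ::
    "nat \<Rightarrow> (nat \<Rightarrow> 'a::euclidean_space) \<Rightarrow> real \<Rightarrow> (nat \<Rightarrow> real) \<Rightarrow> bool" where
  "gram_eigenvector n \<alpha> l x \<longleftrightarrow>
     (\<exists>i\<in>{1..n}. x i \<noteq> 0) \<and> (\<forall>i\<in>{1..n}. (\<Sum>j = 1..n. (\<alpha> i \<bullet> \<alpha> j) * x j) = l * x i)"

definition smallest_gram_eigenvalue ::
    "nat \<Rightarrow> (nat \<Rightarrow> 'a::euclidean_space) \<Rightarrow> real \<Rightarrow> bool" where
  "smallest_gram_eigenvalue n \<alpha> l \<longleftrightarrow>
     (\<exists>x. gram_eigenvector n \<alpha> l x) \<and> (\<forall>k x. gram_eigenvector n \<alpha> k x \<longrightarrow> l \<le> k)"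

definition dual_basis ::
    "'a::euclidean_space set \<Rightarrow> nat \<Rightarrow> (nat \<Rightarrow> 'a) \<Rightarrow> (nat \<Rightarrow> 'a) \<Rightarrow> bool" where
  "dual_basis V n \<alpha> \<omega> \<longleftrightarrow>
     (\<forall>i\<in>{1..n}. \<omega> i \<in> V \<and> (\<forall>j\<in>{1..n}. \<omega> i \<bullet> \<alpha> j = (if i = j then 1 else 0)))"

definition is_coxeter_plane ::
    "'a::euclidean_space set \<Rightarrow> nat \<Rightarrow> (nat \<Rightarrow> 'a \<Rightarrow> 'a) \<Rightarrow> nat set \<Rightarrow> 'a set \<Rightarrow> bool" where
  "is_coxeter_plane V n s J P \<longleftrightarrow>
     (\<exists>\<alpha> l c \<omega>.
        unit_simple_roots V n s \<alpha> \<and>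
        smallest_gram_eigenvalue n \<alpha> l \<and>
        gram_eigenvector n \<alpha> l c \<and> (\<forall>i\<in>{1..n}. c i > 0) \<and>
        dual_basis V n \<alpha> \<omega> \<and>
        P = span {\<Sum>i\<in>J. c i *\<^sub>R \<omega> i, \<Sum>i\<in>{1..n} - J. c i *\<^sub>R \<omega> i})"

definition orth_proj :: "'a::euclidean_space set \<Rightarrow> 'a \<Rightarrow> 'a" where
  "orth_proj P x = (THE y. y \<in> P \<and> (\<forall>z\<in>P. orthogonal (x - y) z))"

text \<open>\<open>p 0, \<dots>, p (m - 1)\<close> are, in this cyclic order, the vertices of a regular \<open>m\<close>-gon in the
  plane \<open>P\<close> centered at the origin. The unit vector \<open>u\<close> points to \<open>p 0\<close>, and either orientation
  of \<open>P\<close> is allowed.\<close>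

definition regular_polygon_seq :: "'a::euclidean_space set \<Rightarrow> nat \<Rightarrow> (nat \<Rightarrow> 'a) \<Rightarrow> bool" where
  "regular_polygon_seq P m p \<longleftrightarrow>
     m \<ge> 3 \<and>
     (\<exists>u v r. norm u = 1 \<and> norm v = 1 \<and> orthogonal u v \<and> span {u, v} = P \<and> r > 0 \<and>
        (\<forall>k<m. p k = r *\<^sub>R (cos (2 * pi * real k / real m) *\<^sub>R u
                             + sin (2 * pi * real k / real m) *\<^sub>R v)))"

definition regular_polygon :: "'a::euclidean_space set \<Rightarrow> nat \<Rightarrow> 'a set \<Rightarrow> bool" where
  "regular_polygon P m X \<longleftrightarrow> (\<exists>p. regular_polygon_seq P m p \<and> X = p ` {..<m})"

end

theory Submission
  imports Defs
begin

text \<open>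
  Put \<open>N = h\<close> and \<open>t i = (2 i - 1) \<pi> / (2 N)\<close>, and consider \<open>u = \<Sum>i. cos (t i) e i\<close> and
  \<open>v = \<Sum>i. - (-1)\<^sup>i sin (t i) e i\<close>, where \<open>i\<close> runs through all coordinates in types \<open>A\<close> and \<open>B\<close>
  and through all but the last one in type \<open>D\<close>. The numbers \<open>x j = u \<bullet> \<alpha> j\<close> are positive, and
  \<open>v \<bullet> \<alpha> j\<close> is a fixed multiple of \<open>x j\<close>, up to a sign that distinguishes the two parts of the
  bipartition. Summation by parts gives \<open>\<Sum>j. x j \<alpha> j = l u\<close>, so \<open>x\<close> is an eigenvector of the Gram
  matrix; by a Perron--Frobenius argument it is the only positive one up to scaling. Hence
  \<open>u\<close> and \<open>v\<close> are multiples of the sum and the difference of the two spanning vectors of the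
  Coxeter plane, and the projection of \<open>e i\<close> is read off from its inner products with \<open>u\<close> and \<open>v\<close>.
\<close>

section \<open>The Coxeter plane from a positive eigenvector\<close>

text \<open>The coordinates of \<open>u\<close> and \<open>v\<close> are read off from the polygon
  that is to appear. Put \<open>e i\<close> at the angle \<open>t i\<close> for odd \<open>i\<close>
  and at \<open>- t i\<close> for even \<open>i\<close>: in type A these are \<open>N\<close>
  equally spaced points of a circle. Exchanging \<open>i\<close> and \<open>i + 1\<close> for all
  odd \<open>i\<close> reflects them in the line at angle \<open>- pi / (2 N)\<close>, for all even
  \<open>i\<close> in the line at angle \<open>pi / (2 N)\<close>, so \<open>c\<close> turns by
  \<open>2 pi / N\<close>. Types B and D reduce to the same picture. In type B, \<open>- e i\<close>
  takes the place numbered \<open>2 n + 1 - i\<close> of a \<open>2 n\<close>-gon. In type D,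
  \<open>s (n - 1) \<circ> s n\<close> negates \<open>e (n - 1)\<close> and \<open>e n\<close> and
  fixes the other coordinate vectors, so on the first \<open>n - 1\<close> coordinates
  \<open>c\<close> is a Coxeter element of type B. The obstacle is that the roots, the eigenvector
  and the dual basis behind the Coxeter plane are only asserted to exist. They have to be matched
  with the explicit data: the roots agree up to one common sign, which the span does not see, and
  positivity identifies the eigenvector.\<close>

lemma reflection_root_unique:
  fixes \<alpha> \<beta> :: "'a::euclidean_space"
  assumes "subspace V" "\<alpha> \<in> V" "\<beta> \<in> V" "norm \<alpha> = 1" "norm \<beta> = 1"
    and "{x \<in> V. \<alpha> \<bullet> x = 0} = {x \<in> V. \<beta> \<bullet> x = 0}"
  shows "\<alpha> = \<beta> \<or> \<alpha> = - \<beta>"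
proof -
  define k where "k = \<alpha> \<bullet> \<beta>"
  \<comment> \<open>The component of \<open>\<alpha>\<close> orthogonal to \<open>\<beta>\<close>
    lies in the common hyperplane, so it is orthogonal to both vectors and hence to itself.\<close>
  define d where "d = \<alpha> - k *\<^sub>R \<beta>"
  have \<beta>\<beta>: "\<beta> \<bullet> \<beta> = 1" and \<alpha>\<alpha>: "\<alpha> \<bullet> \<alpha> = 1"
    using assms(4,5) by (simp_all add: norm_eq_1)
  have "d \<in> V"
    unfolding d_def using assms by (intro subspace_diff subspace_scale)
  moreover have \<beta>d: "\<beta> \<bullet> d = 0"
    by (simp add: d_def k_def inner_diff_right \<beta>\<beta> inner_commute)
  ultimately have "\<alpha> \<bullet> d = 0"
    using assms(6) by blast
  then have "d \<bullet> d = 0"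
    using \<beta>d by (simp add: d_def inner_diff_left)
  then have \<alpha>: "\<alpha> = k *\<^sub>R \<beta>"
    by (simp add: d_def)
  have "k * k = 1"
    using \<alpha>\<alpha> \<beta>\<beta> by (simp add: \<alpha>)
  then have "k = 1 \<or> k = -1"
    by (simp add: square_eq_1_iff)
  then show ?thesis
    using \<alpha> by auto
qed

text \<open>Pairing \<open>x\<close> with \<open>y\<close> through the symmetric matrix gives equal
  eigenvalues, because the pairing of two positive vectors is nonzero. Then the largest multiple
  \<open>t * x\<close> below \<open>y\<close> is subtracted; the difference vanishes somewhere, and
  its zeros spread to all neighbours. Connectedness is phrased as a closure property because it is
  applied to this zero set.\<close>

lemma positive_eigenvector_unique:
  fixes G :: "nat \<Rightarrow> nat \<Rightarrow> real" and x y :: "nat \<Rightarrow> real"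
  assumes "finite I" "I \<noteq> {}"
    and sym: "\<And>i j. G i j = G j i"
    and nonpos: "\<And>i j. i \<in> I \<Longrightarrow> j \<in> I \<Longrightarrow> i \<noteq> j \<Longrightarrow> G i j \<le> 0"
    and conn: "\<And>Z. Z \<subseteq> I \<Longrightarrow> Z \<noteq> {} \<Longrightarrow>
      (\<And>i j. i \<in> Z \<Longrightarrow> j \<in> I \<Longrightarrow> G i j < 0 \<Longrightarrow> j \<in> Z) \<Longrightarrow> Z = I"
    and x: "\<And>i. i \<in> I \<Longrightarrow> x i > 0" "\<And>i. i \<in> I \<Longrightarrow> (\<Sum>j\<in>I. G i j * x j) = k * x i"
    and y: "\<And>i. i \<in> I \<Longrightarrow> y i > 0" "\<And>i. i \<in> I \<Longrightarrow> (\<Sum>j\<in>I. G i j * y j) = l * y i"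
  obtains t where "t > 0" "\<And>i. i \<in> I \<Longrightarrow> y i = t * x i"
proof -
  have "k * (\<Sum>i\<in>I. x i * y i) = (\<Sum>i\<in>I. (\<Sum>j\<in>I. G i j * x j) * y i)"
    using x(2) by (simp add: sum_distrib_left mult.assoc)
  also have "\<dots> = (\<Sum>i\<in>I. \<Sum>j\<in>I. G i j * x j * y i)"
    by (simp add: sum_distrib_right)
  also have "\<dots> = (\<Sum>j\<in>I. \<Sum>i\<in>I. G i j * x j * y i)"
    by (rule sum.swap)
  also have "\<dots> = (\<Sum>j\<in>I. x j * (\<Sum>i\<in>I. G j i * y i))"
    by (intro sum.cong refl) (simp add: sum_distrib_left sym mult_ac)
  also have "\<dots> = l * (\<Sum>i\<in>I. x i * y i)"
    using y(2) by (simp add: sum_distrib_left mult_ac)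
  finally have "k * (\<Sum>i\<in>I. x i * y i) = l * (\<Sum>i\<in>I. x i * y i)" .
  moreover have "(\<Sum>i\<in>I. x i * y i) > 0"
    using assms(1,2) x(1) y(1) by (intro sum_pos) auto
  ultimately have kl: "k = l" by simp
  define t where "t = Min ((\<lambda>i. y i / x i) ` I)"
  define d where "d i = y i - t * x i" for i
  have "t \<in> (\<lambda>i. y i / x i) ` I"
    unfolding t_def using assms(1,2) by (intro Min_in) auto
  then obtain i0 where i0: "i0 \<in> I" "t = y i0 / x i0" by blast
  have d_nonneg: "d i \<ge> 0" if "i \<in> I" for i
  proof -
    have "t \<le> y i / x i"
      unfolding t_def using assms(1) that by (intro Min_le) auto
    then show ?thesis
      using x(1)[OF that] by (simp add: d_def pos_le_divide_eq)
  qed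
  have d_eig: "(\<Sum>j\<in>I. G i j * d j) = l * d i" if "i \<in> I" for i
  proof -
    have "(\<Sum>j\<in>I. G i j * d j) = (\<Sum>j\<in>I. G i j * y j) - t * (\<Sum>j\<in>I. G i j * x j)"
      by (simp add: d_def right_diff_distrib sum_subtractf sum_distrib_left mult_ac)
    then show ?thesis
      using x(2)[OF that] y(2)[OF that] kl by (simp add: d_def algebra_simps)
  qed
  \<comment> \<open>at a zero of the nonnegative eigenvector \<open>d\<close> the terms \<open>G i j * d j \<le> 0\<close> sum to zero\<close>
  have "{i \<in> I. d i = 0} = I"
  proof (rule conn)
    show "{i \<in> I. d i = 0} \<noteq> {}"
      using i0 x(1)[OF i0(1)] by (auto simp: d_def)
    fix i j assume i: "i \<in> {i \<in> I. d i = 0}" and j: "j \<in> I" and neg: "G i j < 0"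
    have le: "G i j' * d j' \<le> 0" if "j' \<in> I" for j'
      using i that nonpos[of i j'] d_nonneg[OF that] by (cases "j' = i") (auto simp: mult_nonpos_nonneg)
    have "(\<Sum>j\<in>I. - (G i j * d j)) = 0"
      using d_eig[of i] i by (simp add: sum_negf)
    then have "- (G i j * d j) = 0"
      using sum_nonneg_eq_0_iff[OF assms(1), of "\<lambda>j. - (G i j * d j)"] le j by auto
    then show "j \<in> {i \<in> I. d i = 0}"
      using neg j by auto
  qed auto
  then have "y i = t * x i" if "i \<in> I" for i
    using that by (auto simp: d_def)
  moreover have "t > 0"
    using i0 x(1) y(1) by simp
  ultimately show ?thesis
    using that by blast
qed

text \<open>The sign chosen at the first root propagates along the diagram: opposite choices at two
  neighbours would make their inner product positive.\<close>

lemma unit_simple_roots_eq_up_to_sign: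
  assumes "subspace V" and roots: "unit_simple_roots V n s \<alpha>" and "n \<ge> 1"
    and \<beta>: "\<And>i. i \<in> {1..n} \<Longrightarrow>
        \<beta> i \<in> V \<and> norm (\<beta> i) = 1 \<and> {x \<in> V. s i x = x} = {x \<in> V. \<beta> i \<bullet> x = 0}"
    and conn: "\<And>Z. Z \<subseteq> {1..n} \<Longrightarrow> Z \<noteq> {} \<Longrightarrow>
      (\<And>i j. i \<in> Z \<Longrightarrow> j \<in> {1..n} \<Longrightarrow> \<beta> i \<bullet> \<beta> j < 0 \<Longrightarrow> j \<in> Z) \<Longrightarrow> Z = {1..n}"
  obtains \<epsilon> :: real where "\<epsilon> * \<epsilon> = 1" "\<And>i. i \<in> {1..n} \<Longrightarrow> \<alpha> i = \<epsilon> *\<^sub>R \<beta> i"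
proof -
  have pm: "\<alpha> i = \<beta> i \<or> \<alpha> i = - \<beta> i" if "i \<in> {1..n}" for i
    using roots \<beta>[OF that] that unfolding unit_simple_roots_def
    by (intro reflection_root_unique[OF \<open>subspace V\<close>]) auto
  obtain \<epsilon> :: real where \<epsilon>: "\<epsilon> * \<epsilon> = 1" "\<alpha> 1 = \<epsilon> *\<^sub>R \<beta> 1"
    using pm[of 1] \<open>n \<ge> 1\<close> by (metis atLeastAtMost_iff mult_1 mult_minus1 minus_minus order_refl
        scaleR_minus1_left scaleR_one)
  have "{i \<in> {1..n}. \<alpha> i = \<epsilon> *\<^sub>R \<beta> i} = {1..n}"
  proof (rule conn)
    show "{i \<in> {1..n}. \<alpha> i = \<epsilon> *\<^sub>R \<beta> i} \<noteq> {}"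
      using \<epsilon> \<open>n \<ge> 1\<close> by auto
    fix i j assume i: "i \<in> {i \<in> {1..n}. \<alpha> i = \<epsilon> *\<^sub>R \<beta> i}" and j: "j \<in> {1..n}"
      and neg: "\<beta> i \<bullet> \<beta> j < 0"
    have "\<alpha> i \<bullet> \<alpha> j \<le> 0"
    proof -
      have "i \<noteq> j" using neg by (metis inner_ge_zero not_le)
      then show ?thesis using roots i j unfolding unit_simple_roots_def by blast
    qed
    have "\<alpha> j = \<epsilon> *\<^sub>R \<beta> j"
    proof (rule ccontr)
      assume "\<alpha> j \<noteq> \<epsilon> *\<^sub>R \<beta> j"
      then have "\<alpha> j = (- \<epsilon>) *\<^sub>R \<beta> j"
        using pm[OF j] \<epsilon>(1) by (auto simp: square_eq_1_iff)
      then have "\<alpha> i \<bullet> \<alpha> j = - (\<epsilon> * \<epsilon>) * (\<beta> i \<bullet> \<beta> j)"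
        using i by simp
      with \<open>\<alpha> i \<bullet> \<alpha> j \<le> 0\<close> neg \<epsilon>(1) show False by simp
    qed
    then show "j \<in> {i \<in> {1..n}. \<alpha> i = \<epsilon> *\<^sub>R \<beta> i}" using j by simp
  qed auto
  then show ?thesis using \<epsilon> that by blast
qed

lemma span_pair_sum_diff:
  fixes a b :: "'a::real_vector"
  assumes "u = p *\<^sub>R (a + b)" "v = q *\<^sub>R (a - b)" "p \<noteq> 0" "q \<noteq> 0"
  shows "span {a, b} = span {u, v}"
proof -
  have "a = (1 / (2 * p)) *\<^sub>R u + (1 / (2 * q)) *\<^sub>R v" "b = (1 / (2 * p)) *\<^sub>R u - (1 / (2 * q)) *\<^sub>R v"
    using assms by (simp_all add: scaleR_add_right scaleR_diff_right flip: scaleR_2 scaleR_add_left)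
  then have "a \<in> span {u, v}" "b \<in> span {u, v}"
    by (metis insertCI span_add span_base span_diff span_scale)+
  moreover have "u \<in> span {a, b}" "v \<in> span {a, b}"
    unfolding assms by (auto intro!: span_scale span_add span_diff intro: span_base)
  ultimately show ?thesis
    by (simp add: span_eq)
qed

text \<open>By \<open>total\<close>, a vector of \<open>V\<close> is determined by its inner
  products with the \<open>\<beta> i\<close>. For the two spanning vectors \<open>a\<close> and
  \<open>b\<close> these are, up to the factor \<open>\<epsilon> * t\<close>, the values
  \<open>u \<bullet> \<beta> i\<close> on \<open>J\<close> and off \<open>J\<close> respectively. So
  \<open>u\<close> is a multiple of \<open>a + b\<close>, and \<open>v\<close>, whose inner products
  change sign off \<open>J\<close>, is a multiple of \<open>a - b\<close>.\<close>

lemma coxeter_plane_eq_span: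
  fixes u v :: "'a::euclidean_space"
  assumes "subspace V" "n \<ge> 1" "J \<subseteq> {1..n}"
    and \<beta>: "\<And>i. i \<in> {1..n} \<Longrightarrow>
        \<beta> i \<in> V \<and> norm (\<beta> i) = 1 \<and> {x \<in> V. s i x = x} = {x \<in> V. \<beta> i \<bullet> x = 0}"
    and conn: "\<And>Z. Z \<subseteq> {1..n} \<Longrightarrow> Z \<noteq> {} \<Longrightarrow>
      (\<And>i j. i \<in> Z \<Longrightarrow> j \<in> {1..n} \<Longrightarrow> \<beta> i \<bullet> \<beta> j < 0 \<Longrightarrow> j \<in> Z) \<Longrightarrow> Z = {1..n}"
    and total: "\<And>x. x \<in> V \<Longrightarrow> (\<And>i. i \<in> {1..n} \<Longrightarrow> \<beta> i \<bullet> x = 0) \<Longrightarrow> x = 0"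
    and "u \<in> V" "v \<in> V"
    and pos: "\<And>i. i \<in> {1..n} \<Longrightarrow> u \<bullet> \<beta> i > 0"
    and eig: "(\<Sum>i = 1..n. (u \<bullet> \<beta> i) *\<^sub>R \<beta> i) = k *\<^sub>R u"
    and "K \<noteq> 0"
    and v: "\<And>i. i \<in> {1..n} \<Longrightarrow> v \<bullet> \<beta> i = K * (if i \<in> J then u \<bullet> \<beta> i else - (u \<bullet> \<beta> i))"
    and "is_coxeter_plane V n s J P"
  shows "P = span {u, v}"
proof -
  obtain \<alpha> l c \<omega> where roots: "unit_simple_roots V n s \<alpha>" and c: "gram_eigenvector n \<alpha> l c"
    and cpos: "\<And>i. i \<in> {1..n} \<Longrightarrow> c i > 0" and dual: "dual_basis V n \<alpha> \<omega>"
    and P: "P = span {\<Sum>i\<in>J. c i *\<^sub>R \<omega> i, \<Sum>i\<in>{1..n} - J. c i *\<^sub>R \<omega> i}"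
    using \<open>is_coxeter_plane V n s J P\<close> unfolding is_coxeter_plane_def by auto
  obtain \<epsilon> :: real where \<epsilon>: "\<epsilon> * \<epsilon> = 1" "\<And>i. i \<in> {1..n} \<Longrightarrow> \<alpha> i = \<epsilon> *\<^sub>R \<beta> i"
    using unit_simple_roots_eq_up_to_sign[OF \<open>subspace V\<close> roots \<open>n \<ge> 1\<close> \<beta> conn] by metis
  have gram: "\<alpha> i \<bullet> \<alpha> j = \<beta> i \<bullet> \<beta> j" if "i \<in> {1..n}" "j \<in> {1..n}" for i j
    using that \<epsilon> by (simp flip: mult.assoc)
  obtain t where "t > 0" and t: "\<And>i. i \<in> {1..n} \<Longrightarrow> c i = t * (u \<bullet> \<beta> i)"
  proof (rule positive_eigenvector_unique)
    show "\<beta> i \<bullet> \<beta> j = \<beta> j \<bullet> \<beta> i" for i j by (rule inner_commute)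
    show "\<beta> i \<bullet> \<beta> j \<le> 0" if "i \<in> {1..n}" "j \<in> {1..n}" "i \<noteq> j" for i j
      using roots that unfolding gram[OF that(1,2), symmetric] unit_simple_roots_def by blast
    \<comment> \<open>Pairing the vector identity \<open>eig\<close> with \<open>\<beta> i\<close>
      gives row \<open>i\<close> of the eigenvector equation for the Gram matrix.\<close>
    show "(\<Sum>j = 1..n. (\<beta> i \<bullet> \<beta> j) * (u \<bullet> \<beta> j)) = k * (u \<bullet> \<beta> i)" if "i \<in> {1..n}" for i
      using arg_cong[OF eig, of "\<lambda>x. x \<bullet> \<beta> i"]
      by (simp add: inner_sum_left inner_commute[of "\<beta> i"] mult.commute)
    show "(\<Sum>j = 1..n. (\<beta> i \<bullet> \<beta> j) * c j) = l * c i" if "i \<in> {1..n}" for i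
    proof -
      have "(\<Sum>j = 1..n. (\<beta> i \<bullet> \<beta> j) * c j) = (\<Sum>j = 1..n. (\<alpha> i \<bullet> \<alpha> j) * c j)"
        by (intro sum.cong refl) (simp add: gram[OF that])
      then show ?thesis using c that unfolding gram_eigenvector_def by auto
    qed
    show "Z = {1..n}"
      if "Z \<subseteq> {1..n}" "Z \<noteq> {}" "\<And>i j. i \<in> Z \<Longrightarrow> j \<in> {1..n} \<Longrightarrow> \<beta> i \<bullet> \<beta> j < 0 \<Longrightarrow> j \<in> Z" for Z
      using that by (rule conn)
  qed (use \<open>n \<ge> 1\<close> pos cpos in simp_all)
  define a where "a = (\<Sum>i\<in>J. c i *\<^sub>R \<omega> i)"
  define b where "b = (\<Sum>i\<in>{1..n} - J. c i *\<^sub>R \<omega> i)"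
  have \<omega>V: "\<omega> i \<in> V" if "i \<in> {1..n}" for i
    using dual that unfolding dual_basis_def by blast
  have "a \<in> V" "b \<in> V"
    unfolding a_def b_def using \<omega>V \<open>J \<subseteq> {1..n}\<close>
    by (auto intro!: subspace_sum subspace_scale \<open>subspace V\<close>)
  have sum_\<omega>: "(\<Sum>i\<in>I. c i *\<^sub>R \<omega> i) \<bullet> \<beta> j = (if j \<in> I then \<epsilon> * c j else 0)"
    if "I \<subseteq> {1..n}" "j \<in> {1..n}" for I j
  proof -
    have "\<beta> j = \<epsilon> *\<^sub>R \<alpha> j"
      using \<epsilon> that(2) by simp
    then have "(\<Sum>i\<in>I. c i *\<^sub>R \<omega> i) \<bullet> \<beta> j = (\<Sum>i\<in>I. \<epsilon> * (c i * (\<omega> i \<bullet> \<alpha> j)))"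
      by (simp add: inner_sum_left sum_distrib_left mult_ac)
    also have "\<dots> = (\<Sum>i\<in>I. if i = j then \<epsilon> * c j else 0)"
      using dual that unfolding dual_basis_def by (intro sum.cong refl) auto
    also have "\<dots> = (if j \<in> I then \<epsilon> * c j else 0)"
      using finite_subset[OF that(1)] by (simp add: sum.delta)
    finally show ?thesis .
  qed
  have ab: "a \<bullet> \<beta> j = (if j \<in> J then \<epsilon> * c j else 0)" "b \<bullet> \<beta> j = (if j \<in> J then 0 else \<epsilon> * c j)"
    if "j \<in> {1..n}" for j
    unfolding a_def b_def using that sum_\<omega>[of J j] sum_\<omega>[of "{1..n} - J" j] \<open>J \<subseteq> {1..n}\<close>
    by auto
  have "\<epsilon> \<noteq> 0" using \<epsilon>(1) by auto
  \<comment> \<open>Pairing \<open>a + b\<close> with \<open>\<beta> i\<close> yields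
    \<open>\<epsilon> * c i = \<epsilon> * t * (u \<bullet> \<beta> i)\<close>, and \<open>p\<close>
    cancels this factor.\<close>
  define p where "p = 1 / (\<epsilon> * t)"
  have p: "p \<noteq> 0" "p * \<epsilon> * t = 1" using \<open>t > 0\<close> \<open>\<epsilon> \<noteq> 0\<close> by (auto simp: p_def)
  have "u - p *\<^sub>R (a + b) = 0"
  proof (rule total)
    show "u - p *\<^sub>R (a + b) \<in> V"
      using \<open>u \<in> V\<close> \<open>a \<in> V\<close> \<open>b \<in> V\<close> \<open>subspace V\<close>
      by (intro subspace_diff subspace_scale subspace_add)
    show "\<beta> i \<bullet> (u - p *\<^sub>R (a + b)) = 0" if "i \<in> {1..n}" for i
      using ab[OF that] t[OF that] p
      by (simp add: inner_commute[of "\<beta> i"] inner_diff_left inner_add_left flip: mult.assoc)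
  qed
  moreover have "v - (K * p) *\<^sub>R (a - b) = 0"
  proof (rule total)
    show "v - (K * p) *\<^sub>R (a - b) \<in> V"
      using \<open>v \<in> V\<close> \<open>a \<in> V\<close> \<open>b \<in> V\<close> \<open>subspace V\<close>
      by (intro subspace_diff subspace_scale)
    show "\<beta> i \<bullet> (v - (K * p) *\<^sub>R (a - b)) = 0" if "i \<in> {1..n}" for i
    proof -
      have "K * p * (\<epsilon> * (t * (u \<bullet> \<beta> i))) = K * (p * \<epsilon> * t) * (u \<bullet> \<beta> i)" by (simp only: mult_ac)
      then show ?thesis
        using ab[OF that] t[OF that] p v[OF that]
        by (simp add: inner_commute[of "\<beta> i"] inner_diff_left)
    qed
  qed
  ultimately have "span {a, b} = span {u, v}"
    using p \<open>K \<noteq> 0\<close> by (intro span_pair_sum_diff[where p = p and q = "K * p"]) auto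
  then show ?thesis by (simp add: P a_def b_def)
qed

section \<open>The spanning vectors\<close>

lemma std_basis_inner:
  assumes "std_basis e M" "i \<in> {1..M}" "j \<in> {1..M}"
  shows "e i \<bullet> e j = (if i = j then 1 else 0)"
proof -
  have "e i \<in> Basis" "e j \<in> Basis" "e i = e j \<longleftrightarrow> i = j"
    using assms unfolding std_basis_def
    by (auto dest: bij_betwE bij_betw_imp_inj_on simp: inj_on_eq_iff)
  then show ?thesis by (simp add: inner_Basis)
qed

lemma std_basis_sum_inner:
  assumes "std_basis e M" "m \<le> M" "j \<in> {1..M}"
  shows "(\<Sum>i = 1..m. a i *\<^sub>R e i) \<bullet> e j = (if j \<le> m then a j else 0)"
proof -
  have "(\<Sum>i = 1..m. a i *\<^sub>R e i) \<bullet> e j = (\<Sum>i = 1..m. if i = j then a j else 0)"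
    unfolding inner_sum_left
    using assms by (intro sum.cong refl) (auto simp: std_basis_inner[OF assms(1)])
  then show ?thesis
    using assms(3) by (simp add: sum.delta)
qed

lemma std_basis_sum_inner_sum:
  assumes "std_basis e M" "m \<le> M"
  shows "(\<Sum>i = 1..m. a i *\<^sub>R e i) \<bullet> (\<Sum>i = 1..m. b i *\<^sub>R e i) = (\<Sum>i = 1..m. a i * b i)"
  unfolding inner_sum_right using assms
  by (intro sum.cong refl) (simp add: std_basis_sum_inner[OF assms] mult.commute del: One_nat_def)

lemma std_basis_eq_0:
  assumes "std_basis e M" "\<And>i. i \<in> {1..M} \<Longrightarrow> x \<bullet> e i = 0"
  shows "x = 0"
proof (rule euclidean_eqI)
  fix b :: 'a assume "b \<in> Basis"
  then obtain i where "i \<in> {1..M}" "b = e i"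
    using assms(1) unfolding std_basis_def bij_betw_def by blast
  then show "x \<bullet> b = 0 \<bullet> b" using assms(2) by simp
qed

lemma linear_eq_std_basis:
  assumes "std_basis e M" "linear f" "linear g" "\<And>i. i \<in> {1..M} \<Longrightarrow> f (e i) = g (e i)"
  shows "f = g"
proof (rule linear_eq_stdbasis[OF assms(2,3)])
  fix b :: 'a assume "b \<in> Basis"
  then obtain i where "i \<in> {1..M}" "b = e i"
    using assms(1) unfolding std_basis_def bij_betw_def by blast
  then show "f b = g b" using assms(4) by simp
qed

section \<open>Telescoping trigonometric sums\<close>

lemma sum_cos_odd_multiples:
  "2 * sin x * (\<Sum>i = 1..m. cos ((2 * real i - 1) * x)) = sin (2 * real m * x)"
proof (induction m)
  case (Suc m)
  have "2 * sin x * cos ((2 * real m + 1) * x) = sin (2 * real m * x + 2 * x) - sin (2 * real m * x)"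
    using sin_diff_sin[of "2 * real m * x + 2 * x" "2 * real m * x"]
    by (simp add: algebra_simps add_divide_distrib)
  then show ?case
    using Suc by (simp add: algebra_simps)
qed simp

text \<open>Multiplying a term by \<open>2 * cos x\<close> gives the sum of the sines of two
  consecutive even multiples of \<open>x\<close>, which telescopes thanks to the alternating sign.
  In the cosine sum the factor \<open>2 * sin x\<close> gives a difference, and no sign is
  required.\<close>

lemma sum_alternating_sin_odd_multiples:
  "2 * cos x * (\<Sum>i = 1..m. (-1) ^ i * sin ((2 * real i - 1) * x)) = (-1) ^ m * sin (2 * real m * x)"
proof (induction m)
  case (Suc m)
  have "2 * cos x * sin ((2 * real m + 1) * x) = sin (2 * real m * x + 2 * x) + sin (2 * real m * x)"
    using sin_plus_sin[of "2 * real m * x + 2 * x" "2 * real m * x"]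
    by (simp add: algebra_simps add_divide_distrib)
  then have "(-1) ^ Suc m * (2 * cos x * sin ((2 * real m + 1) * x))
      = (-1) ^ Suc m * (sin (2 * real m * x + 2 * x) + sin (2 * real m * x))" by simp
  then show ?case
    using Suc by (simp add: algebra_simps)
qed simp

definition vertex_angle :: "nat \<Rightarrow> nat \<Rightarrow> real" where
  "vertex_angle N i = (2 * real i - 1) * pi / (2 * real N)"

text \<open>The number \<open>m\<close> of coordinates is kept apart from the number
  \<open>N\<close> of vertices: \<open>N = m\<close> in type A, and \<open>N = 2 * m\<close> in
  types B and D.\<close>

definition cos_vec :: "(nat \<Rightarrow> 'a::euclidean_space) \<Rightarrow> nat \<Rightarrow> nat \<Rightarrow> 'a" where
  "cos_vec e N m = (\<Sum>i = 1..m. cos (vertex_angle N i) *\<^sub>R e i)"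

definition sin_vec :: "(nat \<Rightarrow> 'a::euclidean_space) \<Rightarrow> nat \<Rightarrow> nat \<Rightarrow> 'a" where
  "sin_vec e N m = (\<Sum>i = 1..m. (- ((-1) ^ i) * sin (vertex_angle N i)) *\<^sub>R e i)"

lemma cos_vec_inner:
  assumes "std_basis e M" "m \<le> M" "j \<in> {1..M}"
  shows "cos_vec e N m \<bullet> e j = (if j \<le> m then cos (vertex_angle N j) else 0)"
  unfolding cos_vec_def by (rule std_basis_sum_inner[OF assms])

lemma sin_vec_inner:
  assumes "std_basis e M" "m \<le> M" "j \<in> {1..M}"
  shows "sin_vec e N m \<bullet> e j = (if j \<le> m then - ((-1) ^ j) * sin (vertex_angle N j) else 0)"
  unfolding sin_vec_def by (rule std_basis_sum_inner[OF assms])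

text \<open>Double-angle formulas reduce all three products to the telescoping sums at
  \<open>x = pi / N\<close>. The divisibility \<open>N dvd 2 * m\<close> makes
  \<open>sin (2 * m * x)\<close> vanish for both \<open>N = m\<close> and \<open>N = 2 * m\<close>,
  and \<open>N \<ge> 3\<close> keeps \<open>sin x\<close> and \<open>cos x\<close> positive, so that
  they can be cancelled.\<close>

lemma cos_vec_sin_vec_inner:
  assumes "std_basis e M" "m \<le> M" "N \<ge> 3" "N dvd 2 * m"
  shows "cos_vec e N m \<bullet> cos_vec e N m = real m / 2"
    and "sin_vec e N m \<bullet> sin_vec e N m = real m / 2"
    and "cos_vec e N m \<bullet> sin_vec e N m = 0"
proof -
  define x where "x = pi / real N"
  have dbl: "2 * vertex_angle N i = (2 * real i - 1) * x" for i
    using assms(3) by (simp add: vertex_angle_def x_def)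
  obtain k where "2 * m = N * k" using assms(4) by blast
  then have "2 * real m = real N * real k" by (metis of_nat_mult of_nat_numeral)
  then have "2 * real m * x = real k * pi"
    using assms(3) by (simp add: x_def)
  then have sin0: "sin (2 * real m * x) = 0" by simp
  have "0 < x" "x < pi / 2"
    using assms(3) by (auto simp: x_def field_simps)
  then have "sin x > 0" "cos x > 0"
    by (auto intro: sin_gt_zero cos_gt_zero)
  then have cos_sum: "(\<Sum>i = 1..m. cos ((2 * real i - 1) * x)) = 0"
    and sin_sum: "(\<Sum>i = 1..m. (-1) ^ i * sin ((2 * real i - 1) * x)) = 0"
    using sum_cos_odd_multiples[of x m] sum_alternating_sin_odd_multiples[of x m] sin0 by auto
  have "cos_vec e N m \<bullet> cos_vec e N m = (\<Sum>i = 1..m. (1 + cos ((2 * real i - 1) * x)) / 2)"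
    unfolding cos_vec_def std_basis_sum_inner_sum[OF assms(1,2)] dbl[symmetric]
    by (intro sum.cong refl) (simp add: cos_double_cos power2_eq_square)
  also have "\<dots> = real m / 2"
    using cos_sum by (simp add: sum.distrib flip: sum_divide_distrib)
  finally show "cos_vec e N m \<bullet> cos_vec e N m = real m / 2" .
  have "sin_vec e N m \<bullet> sin_vec e N m = (\<Sum>i = 1..m. (1 - cos ((2 * real i - 1) * x)) / 2)"
    unfolding sin_vec_def std_basis_sum_inner_sum[OF assms(1,2)] dbl[symmetric]
    by (intro sum.cong refl) (simp add: cos_double_sin power2_eq_square)
  also have "\<dots> = real m / 2"
    using cos_sum by (simp add: sum_subtractf flip: sum_divide_distrib)
  finally show "sin_vec e N m \<bullet> sin_vec e N m = real m / 2" .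
  have "cos_vec e N m \<bullet> sin_vec e N m = (\<Sum>i = 1..m. - ((-1) ^ i * sin ((2 * real i - 1) * x)) / 2)"
    unfolding cos_vec_def sin_vec_def std_basis_sum_inner_sum[OF assms(1,2)] dbl[symmetric]
    by (intro sum.cong refl) (simp add: sin_double)
  also have "\<dots> = 0"
    using sin_sum by (simp add: sum_negf flip: sum_divide_distrib)
  finally show "cos_vec e N m \<bullet> sin_vec e N m = 0" .
qed

section \<open>Inner products with the roots along a path\<close>

definition path_root :: "(nat \<Rightarrow> 'a::euclidean_space) \<Rightarrow> nat \<Rightarrow> 'a" where
  "path_root e j = (1 / sqrt 2) *\<^sub>R (e j - e (j + 1))"

lemma two_times_div_sqrt2: "2 * x / sqrt 2 = sqrt 2 * x"
  using real_div_sqrt[of 2] by (simp add: field_simps)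

text \<open>The angles at \<open>j\<close> and \<open>j + 1\<close> have mean
  \<open>j * pi / N\<close> and half difference \<open>pi / (2 * N)\<close>, so the difference of
  their cosines is a product in which only one factor depends on \<open>j\<close>.\<close>

lemma cos_vec_path_root:
  assumes "std_basis e M" "m \<le> M" "N \<ge> 3" "j \<ge> 1" "j < m"
  shows "cos_vec e N m \<bullet> path_root e j = sqrt 2 * sin (pi / (2 * real N)) * sin (j * pi / N)"
proof -
  have "cos_vec e N m \<bullet> path_root e j = (cos (vertex_angle N j) - cos (vertex_angle N (j + 1))) / sqrt 2"
    using assms
    by (simp add: path_root_def inner_diff_right cos_vec_inner[OF assms(1,2)])
  also have "(vertex_angle N j + vertex_angle N (j + 1)) / 2 = j * pi / N"
    using assms(3) by (simp add: vertex_angle_def field_simps)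
  then have "cos (vertex_angle N j) - cos (vertex_angle N (j + 1))
      = 2 * sin (j * pi / N) * sin ((vertex_angle N (j + 1) - vertex_angle N j) / 2)"
    by (simp only: cos_diff_cos)
  also have "(vertex_angle N (j + 1) - vertex_angle N j) / 2 = pi / (2 * real N)"
    using assms(3) by (simp add: vertex_angle_def field_simps)
  finally show ?thesis by (simp flip: two_times_div_sqrt2)
qed

text \<open>The alternating signs of the coordinates turn the difference into a sum of sines, which
  contains the same factor \<open>sin (j * pi / N)\<close> as the product with
  \<open>cos_vec\<close>.\<close>

lemma sin_vec_path_root:
  assumes "std_basis e M" "m \<le> M" "N \<ge> 3" "j \<ge> 1" "j < m"
  shows "sin_vec e N m \<bullet> path_root e j = - ((-1) ^ j) * (sqrt 2 * cos (pi / (2 * real N)) * sin (j * pi / N))"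
proof -
  have "sin_vec e N m \<bullet> path_root e j
      = - ((-1) ^ j) * (sin (vertex_angle N j) + sin (vertex_angle N (j + 1))) / sqrt 2"
    using assms
    by (simp add: path_root_def inner_diff_right sin_vec_inner[OF assms(1,2)] field_simps)
  also have "(vertex_angle N j + vertex_angle N (j + 1)) / 2 = j * pi / N"
    using assms(3) by (simp add: vertex_angle_def field_simps)
  then have "sin (vertex_angle N j) + sin (vertex_angle N (j + 1))
      = 2 * sin (j * pi / N) * cos ((vertex_angle N j - vertex_angle N (j + 1)) / 2)"
    by (simp only: sin_plus_sin)
  also have "(vertex_angle N j - vertex_angle N (j + 1)) / 2 = - (pi / (2 * real N))"
    using assms(3) by (simp add: vertex_angle_def field_simps)
  finally show ?thesis by (simp flip: two_times_div_sqrt2)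
qed

lemma sum_by_parts:
  fixes e :: "nat \<Rightarrow> 'a::real_vector"
  assumes "f 0 = 0"
  shows "(\<Sum>j = 1..m. f j *\<^sub>R (e j - e (j + 1)))
    = (\<Sum>j = 1..m + 1. (f j - f (j - 1)) *\<^sub>R e j) - f (m + 1) *\<^sub>R e (m + 1)"
proof (induction m)
  case (Suc m)
  then show ?case
    by (simp add: scaleR_diff_left scaleR_diff_right)
qed (simp add: assms)

text \<open>The difference of \<open>sin (j * pi / N)\<close> and its predecessor is a multiple of
  the cosine at the midpoint, which is exactly \<open>vertex_angle N j\<close>; thus summation by
  parts returns \<open>cos_vec\<close>. The boundary term at \<open>e m\<close> vanishes in type A,
  where \<open>m = N\<close>, and is cancelled by the roots at the end of the diagram in types B and
  D.\<close>

lemma sum_cos_vec_path_root: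
  assumes "std_basis e M" "m \<le> M" "N \<ge> 3" "m \<ge> 1"
  shows "(\<Sum>j = 1..m - 1. (cos_vec e N m \<bullet> path_root e j) *\<^sub>R path_root e j)
    = (2 * (sin (pi / (2 * real N)))\<^sup>2) *\<^sub>R cos_vec e N m - (sin (pi / (2 * real N)) * sin (m * pi / N)) *\<^sub>R e m"
proof -
  define S where "S = sin (pi / (2 * real N))"
  define f where "f j = S * sin (real j * pi / N)" for j
  have "(\<Sum>j = 1..m - 1. (cos_vec e N m \<bullet> path_root e j) *\<^sub>R path_root e j)
      = (\<Sum>j = 1..m - 1. f j *\<^sub>R (e j - e (j + 1)))"
  proof (intro sum.cong refl)
    fix j assume "j \<in> {1..m - 1}"
    then have "cos_vec e N m \<bullet> path_root e j = sqrt 2 * f j"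
      using cos_vec_path_root[OF assms(1-3), of j] by (force simp: f_def S_def mult.assoc)
    then show "(cos_vec e N m \<bullet> path_root e j) *\<^sub>R path_root e j = f j *\<^sub>R (e j - e (j + 1))"
      by (simp add: path_root_def)
  qed
  also have "\<dots> = (\<Sum>j = 1..m. (f j - f (j - 1)) *\<^sub>R e j) - f m *\<^sub>R e m"
    using sum_by_parts[of f e "m - 1"] assms(4) by (simp add: f_def)
  also have "(\<Sum>j = 1..m. (f j - f (j - 1)) *\<^sub>R e j) = (\<Sum>j = 1..m. (2 * S\<^sup>2) *\<^sub>R cos (vertex_angle N j) *\<^sub>R e j)"
  proof (intro sum.cong refl)
    fix j assume j: "j \<in> {1..m}"
    have "(real j * pi / N - real (j - 1) * pi / N) / 2 = pi / (2 * real N)"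
      "(real j * pi / N + real (j - 1) * pi / N) / 2 = vertex_angle N j"
      using j assms(3) by (simp_all add: of_nat_diff vertex_angle_def field_simps)
    then have "f j - f (j - 1) = 2 * S\<^sup>2 * cos (vertex_angle N j)"
      using sin_diff_sin[of "real j * pi / N" "real (j - 1) * pi / N"]
      unfolding f_def S_def right_diff_distrib[symmetric]
      by (simp only: power2_eq_square mult_ac)
    then show "(f j - f (j - 1)) *\<^sub>R e j = (2 * S\<^sup>2) *\<^sub>R cos (vertex_angle N j) *\<^sub>R e j"
      by simp
  qed
  finally show ?thesis
    by (simp add: cos_vec_def f_def S_def scaleR_sum_right)
qed

section \<open>Regular polygons\<close>

lemma orth_proj_eqI:
  assumes "subspace P" "y \<in> P" "\<And>z. z \<in> P \<Longrightarrow> orthogonal (x - y) z"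
  shows "orth_proj P x = y"
  unfolding orth_proj_def
proof (rule the_equality)
  show "y \<in> P \<and> (\<forall>z\<in>P. orthogonal (x - y) z)"
    using assms by blast
  fix y' assume y': "y' \<in> P \<and> (\<forall>z\<in>P. orthogonal (x - y') z)"
  have "y' - y \<in> P"
    using y' assms by (intro subspace_diff) auto
  then have "(x - y) \<bullet> (y' - y) = 0" "(x - y') \<bullet> (y' - y) = 0"
    using y' assms(3) by (auto simp: orthogonal_def)
  then have "(y' - y) \<bullet> (y' - y) = 0"
    by (simp add: inner_diff_left)
  then show "y' = y" by simp
qed

lemma orth_proj_span_pair:
  assumes "u \<bullet> u = R" "v \<bullet> v = R" "u \<bullet> v = 0" "R > 0"
  shows "orth_proj (span {u, v}) x = ((u \<bullet> x) / R) *\<^sub>R u + ((v \<bullet> x) / R) *\<^sub>R v"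
proof (rule orth_proj_eqI)
  let ?y = "((u \<bullet> x) / R) *\<^sub>R u + ((v \<bullet> x) / R) *\<^sub>R v"
  show "?y \<in> span {u, v}"
    by (intro span_add span_scale) (auto intro: span_base)
  have "orthogonal (x - ?y) u" "orthogonal (x - ?y) v"
    using assms
    by (simp_all add: orthogonal_def inner_diff_left inner_add_left inner_commute[of x] inner_commute[of v u])
  then show "orthogonal (x - ?y) z" if "z \<in> span {u, v}" for z
    using orthogonal_to_span[OF that, of "x - ?y"] by blast
qed (rule subspace_span)

text \<open>The phase \<open>\<phi>\<close> is absorbed by turning the frame: \<open>u'\<close> and
  \<open>v'\<close> are \<open>u\<close> and \<open>v\<close> rotated by \<open>\<phi>\<close> and
  normalised. The number \<open>r = 1 / sqrt R\<close> is both the normalising factor and the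
  circumradius, since the projection divides the inner products by \<open>R\<close> while
  \<open>u\<close> and \<open>v\<close> have length \<open>sqrt R\<close>.\<close>

lemma regular_polygon_seq_orth_proj:
  fixes u v :: "'a::euclidean_space"
  assumes "m \<ge> 3" and uv: "u \<bullet> u = R" "v \<bullet> v = R" "u \<bullet> v = 0" and "R > 0"
    and p: "\<And>k. k < m \<Longrightarrow> u \<bullet> p k = cos (\<phi> + 2 * pi * real k / real m)"
      "\<And>k. k < m \<Longrightarrow> v \<bullet> p k = sin (\<phi> + 2 * pi * real k / real m)"
  shows "regular_polygon_seq (span {u, v}) m (\<lambda>k. orth_proj (span {u, v}) (p k))"
proof -
  define r where "r = 1 / sqrt R"
  have "r > 0" and r: "r * r * R = 1"
    using \<open>R > 0\<close> by (auto simp: r_def)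
  define u' where "u' = (r * cos \<phi>) *\<^sub>R u + (r * sin \<phi>) *\<^sub>R v"
  define v' where "v' = (- (r * sin \<phi>)) *\<^sub>R u + (r * cos \<phi>) *\<^sub>R v"
  have "u' \<bullet> u' = (r * r * R) * (cos \<phi> * cos \<phi> + sin \<phi> * sin \<phi>)"
    "v' \<bullet> v' = (r * r * R) * (cos \<phi> * cos \<phi> + sin \<phi> * sin \<phi>)" "u' \<bullet> v' = 0"
    by (simp_all add: u'_def v'_def inner_add_left inner_add_right inner_commute[of v u] uv
        algebra_simps del: sin_cos_squared_add3)
  then have orthonormal: "norm u' = 1" "norm v' = 1" "orthogonal u' v'"
    by (simp_all add: r norm_eq_1 orthogonal_def)
  \<comment> \<open>The inverse rotation recovers \<open>u\<close> and \<open>v\<close>, which gives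
    the second inclusion between the spans.\<close>
  have rot: "(sqrt R * cos \<phi>) *\<^sub>R u' - (sqrt R * sin \<phi>) *\<^sub>R v' = ((cos \<phi>)\<^sup>2 + (sin \<phi>)\<^sup>2) *\<^sub>R u"
    "(sqrt R * sin \<phi>) *\<^sub>R u' + (sqrt R * cos \<phi>) *\<^sub>R v' = ((sin \<phi>)\<^sup>2 + (cos \<phi>)\<^sup>2) *\<^sub>R v"
    using \<open>R > 0\<close>
    by (simp_all add: u'_def v'_def r_def scaleR_add_right scaleR_diff_right scaleR_add_left
        power2_eq_square mult.commute) (simp_all flip: scaleR_add_left)
  have "u' \<in> span {u, v}" "v' \<in> span {u, v}"
    unfolding u'_def v'_def by (intro span_add span_scale; simp add: span_base)+
  moreover have "u \<in> span {u', v'}" "v \<in> span {u', v'}"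
    using rot by (simp_all, metis insertCI span_add span_base span_diff span_scale,
        metis insertCI span_add span_base span_scale)
  ultimately have span: "span {u', v'} = span {u, v}"
    by (simp add: span_eq)
  have "orth_proj (span {u, v}) (p k) = r *\<^sub>R (cos (2 * pi * real k / real m) *\<^sub>R u'
      + sin (2 * pi * real k / real m) *\<^sub>R v')" if "k < m" for k
  proof -
    define \<theta> where "\<theta> = 2 * pi * real k / real m"
    have "orth_proj (span {u, v}) (p k) = (r * r * cos (\<phi> + \<theta>)) *\<^sub>R u + (r * r * sin (\<phi> + \<theta>)) *\<^sub>R v"
      using orth_proj_span_pair[OF uv \<open>R > 0\<close>, of "p k"] p[OF that] \<open>R > 0\<close>
      by (simp add: \<theta>_def r_def)
    also have "\<dots> = r *\<^sub>R (cos \<theta> *\<^sub>R u' + sin \<theta> *\<^sub>R v')"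
      by (simp add: u'_def v'_def cos_add sin_add algebra_simps)
    finally show ?thesis by (simp add: \<theta>_def)
  qed
  then show ?thesis
    unfolding regular_polygon_seq_def using \<open>m \<ge> 3\<close> \<open>r > 0\<close> orthonormal span by blast
qed

section \<open>The cyclic order of the indices\<close>

definition odd_step :: "nat \<Rightarrow> nat \<Rightarrow> nat" where
  "odd_step N i = (if odd i then if i < N then i + 1 else i else i - 1)"

text \<open>The two steps are the products of the disjoint transpositions of \<open>i\<close> and
  \<open>i + 1\<close> in \<open>{1..N}\<close> with \<open>i\<close> odd and with \<open>i\<close>
  even, that is, the actions of the two halves of the type A Coxeter element on indices. The guards
  single out the end points without a partner.\<close>

definition even_step :: "nat \<Rightarrow> nat \<Rightarrow> nat" where
  "even_step N i = (if even i then if i < N then i + 1 else i else if i > 1 then i - 1 else i)"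

text \<open>The cycle of \<open>even_step N \<circ> odd_step N\<close> runs up the odd indices and back down the even ones.\<close>

definition cycle_index :: "nat \<Rightarrow> nat \<Rightarrow> nat" where
  "cycle_index N k = (if 2 * k < N then 2 * k + 1 else 2 * (N - k))"

lemma even_step_odd_step_cycle_index:
  assumes "N \<ge> 2" "k < N"
  shows "even_step N (odd_step N (cycle_index N k)) = cycle_index N (Suc k mod N)"
proof (cases "2 * k < N")
  case True
  then show ?thesis
    using assms by (auto simp: cycle_index_def even_step_def odd_step_def)
next
  case False
  show ?thesis
  \<comment> \<open>The last index of the round is 2: the odd step takes it to 1, which the even
    step fixes and where the next round starts.\<close>
  proof (cases "Suc k = N")
    case True
    then show ?thesis
      using assms by (auto simp: cycle_index_def even_step_def odd_step_def)
  next
    case Suc: False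
    have "odd_step N (cycle_index N k) = 2 * (N - k) - 1"
      using False assms by (auto simp: cycle_index_def odd_step_def)
    moreover have "even_step N (2 * (N - k) - 1) = 2 * (N - k) - 2"
      using Suc assms by (auto simp: even_step_def)
    moreover have "cycle_index N (Suc k mod N) = 2 * (N - k) - 2"
      using Suc False assms by (auto simp: cycle_index_def)
    ultimately show ?thesis by simp
  qed
qed

lemma bij_betw_cycle_index: "bij_betw (cycle_index N) {..<N} {1..N}"
proof (rule bij_betw_byWitness[where f' = "\<lambda>i. if odd i then i div 2 else N - i div 2"])
  show "\<forall>k\<in>{..<N}. (if odd (cycle_index N k) then cycle_index N k div 2 else N - cycle_index N k div 2) = k"
    by (auto simp: cycle_index_def)
  show "\<forall>i\<in>{1..N}. cycle_index N (if odd i then i div 2 else N - i div 2) = i"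
    by (auto simp: cycle_index_def elim!: evenE oddE)
  show "cycle_index N ` {..<N} \<subseteq> {1..N}"
    by (auto simp: cycle_index_def)
  show "(\<lambda>i. if odd i then i div 2 else N - i div 2) ` {1..N} \<subseteq> {..<N}"
    by (auto elim!: evenE oddE)
qed

text \<open>Along the cycle the vertex angle is \<open>\<psi>\<close> while the indices are odd and
  \<open>2 * pi - \<psi>\<close> once they are even. The sign of the sine coordinate undoes this
  reflection, so both runs together go round the circle once in equal steps.\<close>

lemma vertex_angle_cycle_index:
  assumes "k < N"
  shows "cos (vertex_angle N (cycle_index N k)) = cos (pi / (2 * real N) + 2 * pi * real k / real N)"
    and "- ((-1) ^ cycle_index N k) * sin (vertex_angle N (cycle_index N k))
      = sin (pi / (2 * real N) + 2 * pi * real k / real N)"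
proof -
  define \<psi> where "\<psi> = pi / (2 * real N) + 2 * pi * real k / real N"
  have "vertex_angle N (cycle_index N k) = (if 2 * k < N then \<psi> else 2 * pi - \<psi>)"
    using assms by (auto simp: cycle_index_def vertex_angle_def \<psi>_def field_simps of_nat_diff)
  moreover have "even (cycle_index N k) \<longleftrightarrow> \<not> 2 * k < N"
    by (auto simp: cycle_index_def)
  ultimately show "cos (vertex_angle N (cycle_index N k)) = cos \<psi>"
    "- ((-1) ^ cycle_index N k) * sin (vertex_angle N (cycle_index N k)) = sin \<psi>"
    by (auto simp: cos_diff sin_diff)
qed

text \<open>The common core of the three types: \<open>f\<close> lists vectors whose inner products
  with \<open>u\<close> and \<open>v\<close> are those of polygon vertices, and \<open>c\<close>
  permutes them as the type A Coxeter element permutes indices. The list is \<open>e\<close> itself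
  in type A and \<open>signed_basis\<close> in types B and D.\<close>

locale cycled_polygon =
  fixes N :: nat and R :: real and u v :: "'a::euclidean_space"
    and f :: "nat \<Rightarrow> 'a" and c :: "'a \<Rightarrow> 'a"
  assumes N: "N \<ge> 3" and R: "R > 0"
    and uv: "u \<bullet> u = R" "v \<bullet> v = R" "u \<bullet> v = 0"
    and u_f: "\<And>i. i \<in> {1..N} \<Longrightarrow> u \<bullet> f i = cos (vertex_angle N i)"
    and v_f: "\<And>i. i \<in> {1..N} \<Longrightarrow> v \<bullet> f i = - ((-1) ^ i) * sin (vertex_angle N i)"
    and c_f: "\<And>i. i \<in> {1..N} \<Longrightarrow> c (f i) = f (even_step N (odd_step N i))"
begin

lemma cycle_index_in: "k < N \<Longrightarrow> cycle_index N k \<in> {1..N}"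
  using bij_betw_cycle_index[of N] by (auto dest: bij_betwE)

lemma funpow_f:
  assumes "j < N"
  shows "(c ^^ k) (f (cycle_index N j)) = f (cycle_index N ((j + k) mod N))"
proof (induction k)
  case (Suc k)
  have "c (f (cycle_index N ((j + k) mod N))) = f (cycle_index N (Suc ((j + k) mod N) mod N))"
    using N cycle_index_in by (simp add: c_f even_step_odd_step_cycle_index)
  then show ?case
    using Suc by (simp add: mod_Suc_eq)
qed (use assms in simp)

text \<open>The inner product with \<open>u\<close> alone separates the vectors: all vertex angles
  lie between 0 and \<open>pi\<close>, where the cosine is injective.\<close>

lemma inj_on_f: "inj_on f {1..N}"
proof (rule inj_onI)
  fix i j assume ij: "i \<in> {1..N}" "j \<in> {1..N}" "f i = f j"
  have angle: "0 \<le> vertex_angle N i \<and> vertex_angle N i \<le> pi" if "i \<in> {1..N}" for i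
  proof -
    have "vertex_angle N i = (2 * real i - 1) / (2 * real N) * pi"
      by (simp add: vertex_angle_def)
    moreover have "0 \<le> (2 * real i - 1) / (2 * real N)" "(2 * real i - 1) / (2 * real N) \<le> 1"
      using that N by auto
    ultimately show ?thesis
      by (simp only: mult_nonneg_nonneg pi_ge_zero mult_left_le_one_le)
  qed
  have "cos (vertex_angle N i) = cos (vertex_angle N j)"
    using u_f[OF ij(1)] u_f[OF ij(2)] ij(3) by simp
  then have "vertex_angle N i = vertex_angle N j"
    using angle[OF ij(1)] angle[OF ij(2)] by (simp add: cos_inj_pi)
  then show "i = j"
    using N by (simp add: vertex_angle_def field_simps)
qed

lemma index_cases:
  assumes "i \<in> {1..N}"
  obtains j where "j < N" "i = cycle_index N j"
  using assms bij_betw_cycle_index[of N] unfolding bij_betw_def by blast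

lemma funpow_f_eq_iff:
  assumes "i \<in> {1..N}"
  shows "(c ^^ k) (f i) = f i \<longleftrightarrow> N dvd k"
proof -
  obtain j where j: "j < N" "i = cycle_index N j"
    using assms by (rule index_cases)
  have mod: "(j + k) mod N < N" using N by simp
  have "(c ^^ k) (f i) = f i \<longleftrightarrow> cycle_index N ((j + k) mod N) = cycle_index N j"
    using inj_on_f j cycle_index_in[OF j(1)] cycle_index_in[OF mod]
    by (auto simp: funpow_f dest: inj_onD)
  also have "\<dots> \<longleftrightarrow> (j + k) mod N = j mod N"
    using bij_betw_imp_inj_on[OF bij_betw_cycle_index[of N]] j(1) mod
    by (auto dest: inj_onD)
  also have "\<dots> \<longleftrightarrow> N dvd k"
    by (metis add.right_neutral add_diff_cancel_left' le_add1 mod_eq_dvd_iff_nat)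
  finally show ?thesis .
qed

lemma regular_polygon_seq_funpow:
  assumes "i \<in> {1..N}"
  shows "regular_polygon_seq (span {u, v}) N (\<lambda>k. orth_proj (span {u, v}) ((c ^^ k) (f i)))"
proof -
  obtain j where j: "j < N" "i = cycle_index N j"
    using assms by (rule index_cases)
  define \<phi> where "\<phi> = pi / (2 * real N) + 2 * pi * real j / real N"
  have "u \<bullet> (c ^^ k) (f i) = cos (\<phi> + 2 * pi * real k / real N)"
    "v \<bullet> (c ^^ k) (f i) = sin (\<phi> + 2 * pi * real k / real N)" if "k < N" for k
  proof -
    \<comment> \<open>Wrapping round the cycle lowers the position by a multiple of \<open>N\<close>
      and so the angle by a multiple of \<open>2 * pi\<close>.\<close>
    define k' where "k' = (j + k) mod N"
    have k': "k' < N" using N by (simp add: k'_def)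
    have "j + k = k' + N * ((j + k) div N)"
      by (simp add: k'_def)
    then have "real j + real k = real k' + real N * real ((j + k) div N)"
      by (metis of_nat_add of_nat_mult)
    then have "2 * pi * (real j + real k) / real N = 2 * pi * real k' / real N + 2 * pi * real ((j + k) div N)"
      using N by (simp add: distrib_left add_divide_distrib)
    then have "\<phi> + 2 * pi * real k / real N
        = (pi / (2 * real N) + 2 * pi * real k' / real N) + 2 * pi * real ((j + k) div N)"
      by (simp add: \<phi>_def distrib_left add_divide_distrib)
    moreover have "sin (x + 2 * pi * real d) = sin x" "cos (x + 2 * pi * real d) = cos x" for x d
      using sin.plus_of_nat[of x d] cos.plus_of_nat[of x d] by (simp_all add: mult_ac)
    ultimately show "u \<bullet> (c ^^ k) (f i) = cos (\<phi> + 2 * pi * real k / real N)"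
      "v \<bullet> (c ^^ k) (f i) = sin (\<phi> + 2 * pi * real k / real N)"
      using vertex_angle_cycle_index[OF k'] u_f[OF cycle_index_in[OF k']] v_f[OF cycle_index_in[OF k']]
      by (simp_all add: j(2) funpow_f[OF j(1)] flip: k'_def)
  qed
  then show ?thesis
    by (rule regular_polygon_seq_orth_proj[OF N uv R])
qed

lemma image_funpow:
  assumes "i \<in> {1..N}"
  shows "(\<lambda>k. (c ^^ k) (f i)) ` {..<N} = f ` {1..N}"
proof -
  obtain j where j: "j < N" "i = cycle_index N j"
    using assms by (rule index_cases)
  have "(\<lambda>k. (j + k) mod N) ` {..<N} = {..<N}"
  proof (intro equalityI subsetI)
    fix l assume "l \<in> {..<N}"
    moreover have "(j + (l + (N - j)) mod N) mod N = (l + N) mod N"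
      using j(1) by (simp add: mod_add_right_eq)
    ultimately show "l \<in> (\<lambda>k. (j + k) mod N) ` {..<N}"
      using N by (intro image_eqI[of _ _ "(l + (N - j)) mod N"]) auto
  qed (use N in auto)
  then have "f ` cycle_index N ` (\<lambda>k. (j + k) mod N) ` {..<N} = f ` {1..N}"
    using bij_betw_imp_surj_on[OF bij_betw_cycle_index[of N]] by simp
  then show ?thesis
    by (simp add: j(2) funpow_f[OF j(1)] image_image)
qed

lemma regular_polygon_image:
  "regular_polygon (span {u, v}) N (orth_proj (span {u, v}) ` f ` {1..N})"
proof -
  have 1: "1 \<in> {1..N}" using N by simp
  then have "orth_proj (span {u, v}) ` f ` {1..N}
      = (\<lambda>k. orth_proj (span {u, v}) ((c ^^ k) (f 1))) ` {..<N}"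
    by (simp only: image_image flip: image_funpow)
  then show ?thesis
    unfolding regular_polygon_def using regular_polygon_seq_funpow[OF 1] by blast
qed

lemma cyclic_on_image: "cyclic_on c (f ` {1..N})"
proof -
  have 1: "1 \<in> {1..N}" using N by simp
  then have "(c ^^ N) (f 1) = f 1" by (simp only: funpow_f_eq_iff dvd_refl)
  then have "orbit c (f 1) = f ` {1..N}"
    using orbit_altdef_bounded[of N c "f 1"] N image_funpow[OF 1] by (simp add: image_def lessThan_def) blast
  then show ?thesis
    unfolding cyclic_on_def using 1 by blast
qed

text \<open>A power equal to the identity fixes \<open>f 1\<close>, so its exponent is a multiple of
  \<open>N\<close>. The premise on \<open>c ^^ N\<close> is separate because the \<open>f i\<close>
  need not span the space: in type D they miss the last coordinate.\<close>

lemma Least_funpow_eq_id: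
  assumes "c ^^ N = id"
  shows "(LEAST k. k > 0 \<and> c ^^ k = id) = N"
proof (rule Least_equality)
  show "N > 0 \<and> c ^^ N = id" using assms N by simp
  fix k assume k: "k > 0 \<and> c ^^ k = id"
  then have "N dvd k"
    using funpow_f_eq_iff[of 1 k] N by simp
  then show "N \<le> k" using k by (simp add: dvd_imp_le)
qed

end

section \<open>The Coxeter element\<close>

lemma foldr_comp_fixed:
  "\<forall>j\<in>set xs. s j x = x \<Longrightarrow> foldr (\<lambda>i w. s i \<circ> w) xs id x = x"
  by (induction xs) simp_all

lemma refl_prod_fixed:
  assumes "finite J" "\<And>j. j \<in> J \<Longrightarrow> s j x = x"
  shows "refl_prod s J x = x"
  unfolding refl_prod_def using assms by (intro foldr_comp_fixed) simp

text \<open>The factors applied before \<open>s i\<close> meet \<open>x\<close> and those applied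
  after it meet \<open>y\<close>; both vectors have to be fixed by all factors other than
  \<open>s i\<close>.\<close>

lemma refl_prod_single:
  assumes "finite J" "i \<in> J" "s i x = y"
    and "\<And>j. j \<in> J \<Longrightarrow> j \<noteq> i \<Longrightarrow> s j x = x" "\<And>j. j \<in> J \<Longrightarrow> j \<noteq> i \<Longrightarrow> s j y = y"
  shows "refl_prod s J x = y"
proof -
  have "foldr (\<lambda>i w. s i \<circ> w) xs id x = y"
    if "distinct xs" "i \<in> set xs" "\<forall>j\<in>set xs. j \<noteq> i \<longrightarrow> s j x = x \<and> s j y = y" for xs
    using that
  proof (induction xs)
    case (Cons a xs)
    show ?case
    proof (cases "a = i")
      case True
      then have "foldr (\<lambda>i w. s i \<circ> w) xs id x = x"
        using Cons.prems by (intro foldr_comp_fixed) auto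
      moreover have "foldr (\<lambda>i w. s i \<circ> w) (a # xs) id x = s a (foldr (\<lambda>i w. s i \<circ> w) xs id x)"
        by simp
      ultimately show ?thesis using True \<open>s i x = y\<close> by metis
    next
      case False
      then show ?thesis using Cons by simp
    qed
  qed simp
  then show ?thesis
    unfolding refl_prod_def using assms by simp
qed

text \<open>The product is formed in increasing order, so the greatest index is the innermost
  factor. This is how the last two reflections of type D are brought together.\<close>

lemma refl_prod_insert_greatest:
  assumes "finite J" "\<And>j. j \<in> J \<Longrightarrow> j < m"
  shows "refl_prod s (insert m J) = refl_prod s J \<circ> s m"
proof -
  have "sorted_list_of_set (insert m J) = sorted_list_of_set J @ [m]"
    using assms
    by (intro sorted_distinct_set_unique)
      (auto simp: sorted_append less_imp_le simp del: sorted_list_of_set_insert_remove)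
  moreover have "foldr (\<lambda>i w. s i \<circ> w) xs (s m) = foldr (\<lambda>i w. s i \<circ> w) xs id \<circ> s m" for xs
    by (induction xs) (simp_all add: comp_assoc)
  ultimately show ?thesis
    unfolding refl_prod_def by (simp del: sorted_list_of_set_insert_remove)
qed

lemma refl_prod_cong:
  assumes "finite J" "\<And>j. j \<in> J \<Longrightarrow> s j = s' j"
  shows "refl_prod s J = refl_prod s' J"
  unfolding refl_prod_def using assms by (intro foldr_cong) auto

lemma linear_refl_prod:
  fixes s :: "nat \<Rightarrow> 'a::real_vector \<Rightarrow> 'a"
  assumes "finite J" "\<And>j. j \<in> J \<Longrightarrow> linear (s j)"
  shows "linear (refl_prod s J)"
proof -
  have "linear (foldr (\<lambda>i w. s i \<circ> w) xs id)" if "\<forall>j\<in>set xs. linear (s j)" for xs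
    using that by (induction xs) (auto intro!: linear_compose simp: id_def intro: linear_ident)
  then show ?thesis
    unfolding refl_prod_def using assms by simp
qed

lemma linear_coxeter_elt:
  fixes s :: "nat \<Rightarrow> 'a::real_vector \<Rightarrow> 'a"
  assumes "\<And>j. j \<in> {1..n} \<Longrightarrow> linear (s j)" "J \<subseteq> {1..n}"
  shows "linear (coxeter_elt s n J)"
  unfolding coxeter_elt_def using assms
  by (intro linear_compose linear_refl_prod) (auto intro: finite_subset)

lemma linear_funpow:
  fixes c :: "'a::real_vector \<Rightarrow> 'a"
  assumes "linear c"
  shows "linear (c ^^ k)"
  using assms by (induction k) (auto intro!: linear_compose simp: id_def intro: linear_ident)

lemma plus_AB_subset: "plus_AB n \<subseteq> {1..n}" and finite_plus_AB: "finite (plus_AB n)"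
  and Diff_plus_AB: "{1..n} - plus_AB n = {i \<in> {1..n}. even i}"
  by (auto simp: plus_AB_def)

text \<open>The transpositions within one half are disjoint, so each coordinate vector is moved by
  at most one of them: the one indexed by \<open>i\<close> or by \<open>i - 1\<close>, whichever has
  the right parity. None exists at an end point whose partner falls outside the range.\<close>

lemma coxeter_elt_A:
  assumes s: "\<And>i j. i \<in> {1..n + 1} \<Longrightarrow> j \<in> {1..n} \<Longrightarrow> s j (e i) = e (Transposition.transpose j (j + 1) i)"
    and i: "i \<in> {1..n + 1}"
  shows "coxeter_elt s n (plus_AB n) (e i) = e (even_step (n + 1) (odd_step (n + 1) i))"
proof -
  have fixed: "s j (e i) = e i" if "i \<in> {1..n + 1}" "j \<in> {1..n}" "i \<noteq> j" "i \<noteq> j + 1" for i j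
    using that s[of i j] by (simp add: Transposition.transpose_def)
  have odd: "refl_prod s (plus_AB n) (e i) = e (odd_step (n + 1) i)" if i: "i \<in> {1..n + 1}" for i
  proof (cases "odd i \<and> i = n + 1")
    case True
    have "s l (e i) = e i" if "l \<in> plus_AB n" for l
      using that True i by (intro fixed) (auto simp: plus_AB_def)
    moreover have "odd_step (n + 1) i = i"
      using True by (auto simp: odd_step_def)
    ultimately show ?thesis
      by (simp only:) (intro refl_prod_fixed finite_plus_AB; simp)
  next
    case False
    define j where "j = (if odd i then i else i - 1)"
    have j: "j \<in> plus_AB n" "odd_step (n + 1) i = Transposition.transpose j (j + 1) i"
      using i False by (auto simp: j_def plus_AB_def odd_step_def Transposition.transpose_def elim!: evenE)
    show ?thesis
      unfolding j(2)
    proof (rule refl_prod_single[OF finite_plus_AB j(1)])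
      show "s j (e i) = e (Transposition.transpose j (j + 1) i)"
        using i j(1) by (intro s) (auto simp: plus_AB_def)
      fix l assume l: "l \<in> plus_AB n" "l \<noteq> j"
      have "s l (e k) = e k" if "k \<in> {j, j + 1}" for k
        using that l j(1) by (intro fixed) (auto simp: plus_AB_def)
      moreover have "i \<in> {j, j + 1}"
        using i by (auto simp: j_def)
      ultimately show "s l (e i) = e i"
        "s l (e (Transposition.transpose j (j + 1) i)) = e (Transposition.transpose j (j + 1) i)"
        by auto
    qed
  qed
  have even: "refl_prod s ({1..n} - plus_AB n) (e i) = e (even_step (n + 1) i)" if i: "i \<in> {1..n + 1}" for i
  proof (cases "i = 1 \<or> even i \<and> i = n + 1")
    case True
    have "s l (e i) = e i" if "l \<in> {i \<in> {1..n}. even i}" for l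
      using that True i by (intro fixed) auto
    moreover have "even_step (n + 1) i = i"
      using True by (auto simp: even_step_def)
    ultimately show ?thesis
      unfolding Diff_plus_AB by (simp only:) (intro refl_prod_fixed; simp)
  next
    case False
    define j where "j = (if even i then i else i - 1)"
    have j: "j \<in> {i \<in> {1..n}. even i}" "even_step (n + 1) i = Transposition.transpose j (j + 1) i"
      using i False by (auto simp: j_def even_step_def Transposition.transpose_def elim!: oddE)
    show ?thesis
      unfolding j(2) Diff_plus_AB
    proof (rule refl_prod_single[OF _ j(1)])
      show "s j (e i) = e (Transposition.transpose j (j + 1) i)"
        using i j(1) by (intro s) auto
      fix l assume l: "l \<in> {i \<in> {1..n}. even i}" "l \<noteq> j"
      have "s l (e k) = e k" if "k \<in> {j, j + 1}" for k
        using that l j(1) by (intro fixed) auto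
      moreover have "i \<in> {j, j + 1}"
        using i by (auto simp: j_def)
      ultimately show "s l (e i) = e i"
        "s l (e (Transposition.transpose j (j + 1) i)) = e (Transposition.transpose j (j + 1) i)"
        by auto
    qed simp
  qed
  have "odd_step (n + 1) i \<in> {1..n + 1}"
    using i by (auto simp: odd_step_def elim!: evenE)
  then show ?thesis
    by (simp only: coxeter_elt_def comp_apply odd[OF i] even)
qed

text \<open>Folding: the \<open>2 m\<close> vectors \<open>\<plusminus> e i\<close> are numbered so that the type \<open>B m\<close> Coxeter element
  acts on them as the type \<open>A (2 m - 1)\<close> one acts on coordinate vectors.\<close>

definition signed_basis :: "(nat \<Rightarrow> 'a::real_vector) \<Rightarrow> nat \<Rightarrow> nat \<Rightarrow> 'a" where
  "signed_basis e m i = (if i \<le> m then e i else - e (2 * m + 1 - i))"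

lemma signed_basis_flip:
  "i \<in> {1..2 * m} \<Longrightarrow> signed_basis e m (2 * m + 1 - i) = - signed_basis e m i"
  by (auto simp: signed_basis_def)

lemma signed_basis_image: "signed_basis e m ` {1..2 * m} = e ` {1..m} \<union> (\<lambda>i. - e i) ` {1..m}"
proof (intro equalityI subsetI)
  fix x assume "x \<in> signed_basis e m ` {1..2 * m}"
  then obtain i where i: "i \<in> {1..2 * m}" "x = signed_basis e m i" by blast
  show "x \<in> e ` {1..m} \<union> (\<lambda>i. - e i) ` {1..m}"
  proof (cases "i \<le> m")
    case False
    then have "x = - e (2 * m + 1 - i)" "2 * m + 1 - i \<in> {1..m}"
      using i by (auto simp: signed_basis_def)
    then show ?thesis by blast
  qed (use i in \<open>auto simp: signed_basis_def\<close>)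
next
  fix x assume "x \<in> e ` {1..m} \<union> (\<lambda>i. - e i) ` {1..m}"
  then consider i where "i \<in> {1..m}" "x = e i" | i where "i \<in> {1..m}" "x = - e i" by blast
  then show "x \<in> signed_basis e m ` {1..2 * m}"
  proof cases
    case 1
    then show ?thesis by (intro image_eqI[of _ _ i]) (auto simp: signed_basis_def)
  next
    case 2
    then show ?thesis by (intro image_eqI[of _ _ "2 * m + 1 - i"]) (auto simp: signed_basis_def)
  qed
qed

text \<open>Replacing \<open>i\<close> by \<open>2 * m + 1 - i\<close> negates the vector, so for a
  linear map it suffices to check the first \<open>m\<close> vectors, provided that \<open>t\<close>
  commutes with this flip.\<close>

lemma linear_on_signed_basis:
  assumes "linear g" "\<And>i. i \<in> {1..m} \<Longrightarrow> g (e i) = signed_basis e m (t i)"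
    and t: "\<And>i. i \<in> {1..2 * m} \<Longrightarrow> t i \<in> {1..2 * m} \<and> t (2 * m + 1 - i) = 2 * m + 1 - t i"
    and i: "i \<in> {1..2 * m}"
  shows "g (signed_basis e m i) = signed_basis e m (t i)"
proof (cases "i \<le> m")
  case True
  then show ?thesis using assms(2)[of i] i by (simp add: signed_basis_def)
next
  case False
  define k where "k = 2 * m + 1 - i"
  have k: "k \<in> {1..m}" "k \<in> {1..2 * m}" "i = 2 * m + 1 - k"
    using False i by (auto simp: k_def)
  have "g (signed_basis e m i) = - g (e k)"
    using False by (simp add: signed_basis_def k_def linear_neg[OF \<open>linear g\<close>])
  also have "\<dots> = signed_basis e m (2 * m + 1 - t k)"
    using assms(2)[OF k(1)] t[OF k(2)] signed_basis_flip[of "t k" m e] by (simp del: One_nat_def)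
  finally show ?thesis using t[OF k(2)] k(3) by simp
qed

text \<open>The flip takes the pair \<open>i\<close>, \<open>i + 1\<close> to the pair
  \<open>2 * m - i\<close>, \<open>2 * m + 1 - i\<close>, whose lower member has the same parity as
  \<open>i\<close>. Hence it respects the pairs of odd and of even steps alike.\<close>

lemma odd_step_flip:
  "i \<in> {1..2 * m} \<Longrightarrow> odd_step (2 * m) i \<in> {1..2 * m} \<and>
    odd_step (2 * m) (2 * m + 1 - i) = 2 * m + 1 - odd_step (2 * m) i"
  by (auto simp: odd_step_def elim!: evenE oddE)

lemma even_step_flip:
  "i \<in> {1..2 * m} \<Longrightarrow> even_step (2 * m) i \<in> {1..2 * m} \<and>
    even_step (2 * m) (2 * m + 1 - i) = 2 * m + 1 - even_step (2 * m) i"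
  by (auto simp: even_step_def elim!: evenE oddE)

text \<open>On signed indices \<open>s m\<close> is the single transposition of \<open>m\<close> and
  \<open>m + 1\<close>, because \<open>- e m\<close> has the index \<open>m + 1\<close>. Every other
  \<open>s j\<close> acts as two transpositions exchanged by the flip, both of the parity of
  \<open>j\<close>.\<close>

lemma coxeter_elt_B:
  fixes s :: "nat \<Rightarrow> 'a::real_vector \<Rightarrow> 'a"
  assumes lin: "\<And>j. j \<in> {1..m} \<Longrightarrow> linear (s j)"
    and s: "\<And>i j. i \<in> {1..m} \<Longrightarrow> j \<in> {1..<m} \<Longrightarrow> s j (e i) = e (Transposition.transpose j (j + 1) i)"
    and sm: "\<And>i. i \<in> {1..<m} \<Longrightarrow> s m (e i) = e i" "s m (e m) = - e m"
    and i: "i \<in> {1..2 * m}"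
  shows "coxeter_elt s m (plus_AB m) (signed_basis e m i)
    = signed_basis e m (even_step (2 * m) (odd_step (2 * m) i))"
proof -
  have fixed: "s j (e i) = e i" if "i \<in> {1..m}" "j \<in> {1..m}" "i \<noteq> j" "i \<noteq> j + 1" for i j
    using that s[of i j] sm(1)[of i] by (cases "j = m") (auto simp: Transposition.transpose_def)
  have step_up: "s i (e i) = e (i + 1)" if "i \<in> {1..<m}" for i
    using that s[of i i] by simp
  have step_down: "s (i - 1) (e i) = e (i - 1)" if "i \<in> {2..m}" for i
  proof -
    have "i \<in> {1..m}" "i - 1 \<in> {1..<m}" "i = i - 1 + 1" using that by auto
    then show ?thesis using s[of i "i - 1"] by (metis transpose_apply_second)
  qed
  \<comment> \<open>A set without adjacent indices contains at most one of \<open>i\<close> and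
    \<open>i - 1\<close>, the only reflections that move \<open>e i\<close>; this treats both halves
    at once. For \<open>i = 1\<close> the index \<open>i - 1\<close> is 0 and never in
    \<open>J\<close>, so \<open>e 1\<close> is fixed unless \<open>1 \<in> J\<close>.\<close>
  have parity: "refl_prod s J (e i)
      = (if i \<in> J then if i < m then e (i + 1) else - e m else if i - 1 \<in> J then e (i - 1) else e i)"
    if J: "J \<subseteq> {1..m}" "\<And>j. j \<in> J \<Longrightarrow> j + 1 \<notin> J" and i: "i \<in> {1..m}" for J i
  proof -
    have fin: "finite J" using J(1) by (rule finite_subset) simp
    have s_neg: "s j (- e m) = - e m" if "j \<in> J" "j \<noteq> m" "m \<in> J" for j
    proof -
      have "j + 1 \<noteq> m" using J(2)[OF that(1)] that(3) by metis
      then have "s j (e m) = e m" using that J(1) by (intro fixed) auto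
      then show ?thesis using lin[of j] that J(1) by (auto simp: linear_neg)
    qed
    consider "i \<in> J" "i < m" | "i \<in> J" "i = m" | "i \<notin> J" "i - 1 \<in> J" | "i \<notin> J" "i - 1 \<notin> J"
      using i by fastforce
    then show ?thesis
    proof cases
      case 1
      have "refl_prod s J (e i) = e (i + 1)"
      proof (rule refl_prod_single[OF fin 1(1)])
        show "s i (e i) = e (i + 1)" using 1 i by (intro step_up) auto
        fix j assume j: "j \<in> J" "j \<noteq> i"
        then have "j + 1 \<noteq> i" "j \<noteq> i + 1" "j \<in> {1..m}" using J 1(1) by blast+
        then show "s j (e i) = e i" "s j (e (i + 1)) = e (i + 1)"
          using fixed[of i j] fixed[of "i + 1" j] i 1 j by auto
      qed
      then show ?thesis using 1 by simp
    next
      case 2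
      have "refl_prod s J (e i) = - e m"
      proof (rule refl_prod_single[OF fin 2(1)])
        show "s i (e i) = - e m" using 2 sm by simp
        fix j assume j: "j \<in> J" "j \<noteq> i"
        then have "j + 1 \<noteq> i" "j \<in> {1..m}" using J 2(1) by blast+
        then show "s j (e i) = e i" "s j (- e m) = - e m"
          using fixed[of i j] s_neg[of j] i 2 j by auto
      qed
      then show ?thesis using 2 by simp
    next
      case 3
      then have i2: "i \<in> {2..m}" using J(1) i by (cases "i = 1") auto
      have "refl_prod s J (e i) = e (i - 1)"
      proof (rule refl_prod_single[OF fin 3(2)])
        show "s (i - 1) (e i) = e (i - 1)" using i2 by (rule step_down)
        fix j assume j: "j \<in> J" "j \<noteq> i - 1"
        then have "j + 1 \<notin> J" "j \<in> {1..m}" using J by blast+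
        then have "j + 1 \<noteq> i - 1" "j \<noteq> i" using 3 j by metis+
        moreover have "i - 1 \<in> {1..m}" "i \<in> {1..m}" "i \<noteq> j + 1" using i2 j(2) by auto
        ultimately show "s j (e i) = e i" "s j (e (i - 1)) = e (i - 1)"
          using \<open>j \<in> {1..m}\<close> j(2) by (metis fixed)+
      qed
      then show ?thesis using 3 by simp
    next
      case 4
      have "refl_prod s J (e i) = e i"
      proof (rule refl_prod_fixed[OF fin])
        fix j assume "j \<in> J"
        then show "s j (e i) = e i" using 4 J(1) i by (intro fixed) auto
      qed
      then show ?thesis using 4 by simp
    qed
  qed
  have odd: "refl_prod s (plus_AB m) (e i) = signed_basis e m (odd_step (2 * m) i)" if i: "i \<in> {1..m}" for i
  proof -
    have "refl_prod s (plus_AB m) (e i) = (if odd i then if i < m then e (i + 1) else - e m else e (i - 1))"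
      using i by (subst parity) (auto simp: plus_AB_def)
    also have "\<dots> = signed_basis e m (odd_step (2 * m) i)"
      using i by (cases "i = m") (auto simp: odd_step_def signed_basis_def)
    finally show ?thesis .
  qed
  have even: "refl_prod s ({1..m} - plus_AB m) (e i) = signed_basis e m (even_step (2 * m) i)"
    if i: "i \<in> {1..m}" for i
  proof -
    have "refl_prod s ({1..m} - plus_AB m) (e i)
        = (if even i then if i < m then e (i + 1) else - e m else if i > 1 then e (i - 1) else e i)"
      unfolding Diff_plus_AB using i by (subst parity) auto
    also have "\<dots> = signed_basis e m (even_step (2 * m) i)"
      using i by (cases "i = m") (auto simp: even_step_def signed_basis_def)
    finally show ?thesis .
  qed
  have "linear (refl_prod s (plus_AB m))"
    by (rule linear_refl_prod[OF finite_plus_AB]) (auto simp: plus_AB_def intro: lin)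
  note odd' = linear_on_signed_basis[OF this odd odd_step_flip]
  have "linear (refl_prod s ({1..m} - plus_AB m))"
    by (rule linear_refl_prod) (auto intro: lin)
  note even' = linear_on_signed_basis[OF this even even_step_flip]
  show ?thesis
    using i odd_step_flip[OF i] by (simp only: coxeter_elt_def comp_apply odd' even')
qed

text \<open>The last two reflections belong to the same part, so they can be merged into one factor.
  Index \<open>n\<close> is the innermost factor of its half and \<open>n - 1\<close> comes next, so
  the merged factor takes the place of the last reflection of type B with one coordinate
  fewer.\<close>

lemma coxeter_elt_D:
  assumes "n \<ge> 2"
  shows "coxeter_elt s n (plus_D n) = coxeter_elt (s(n - 1 := s (n - 1) \<circ> s n)) (n - 1) (plus_AB (n - 1))"
proof -
  let ?s = "s(n - 1 := s (n - 1) \<circ> s n)"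
  have last: "refl_prod s (insert n (insert (n - 1) J)) = refl_prod ?s (insert (n - 1) J)"
    if J: "\<And>j. j \<in> J \<Longrightarrow> j < n - 1" for J
  proof -
    have fin: "finite J" using J by (intro finite_subset[of J "{..<n - 1}"]) auto
    have "refl_prod s (insert n (insert (n - 1) J)) = refl_prod s (insert (n - 1) J) \<circ> s n"
      using fin J assms by (intro refl_prod_insert_greatest) force+
    also have "refl_prod s (insert (n - 1) J) = refl_prod s J \<circ> s (n - 1)"
      using fin J by (intro refl_prod_insert_greatest) auto
    also have "refl_prod s J = refl_prod ?s J"
      using fin J by (intro refl_prod_cong) auto
    also have "refl_prod ?s (insert (n - 1) J) = refl_prod ?s J \<circ> ?s (n - 1)"
      using fin J by (intro refl_prod_insert_greatest) auto
    ultimately show ?thesis by (simp add: comp_assoc fun_eq_iff)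
  qed
  have others: "refl_prod s J = refl_prod ?s J" if "\<And>j. j \<in> J \<Longrightarrow> j < n - 1" for J
    using that by (intro refl_prod_cong finite_subset[of J "{..<n - 1}"]) auto
  show ?thesis
  proof (cases "odd (n - 1)")
    case True
    have "plus_D n = insert n (insert (n - 1) {i \<in> {1..<n - 1}. odd i})"
      "plus_AB (n - 1) = insert (n - 1) {i \<in> {1..<n - 1}. odd i}"
      "{1..n} - plus_D n = {i \<in> {1..<n - 1}. even i}"
      "{1..n - 1} - plus_AB (n - 1) = {i \<in> {1..<n - 1}. even i}"
      using True assms by (rule_tac [!] set_eqI) (simp_all add: plus_D_def plus_AB_def, presburger+)
    then show ?thesis
      unfolding coxeter_elt_def
      using last[of "{i \<in> {1..<n - 1}. odd i}"] others[of "{i \<in> {1..<n - 1}. even i}"]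
      by simp
  next
    case False
    have "{1..n} - plus_D n = insert n (insert (n - 1) {i \<in> {1..<n - 1}. even i})"
      "{1..n - 1} - plus_AB (n - 1) = insert (n - 1) {i \<in> {1..<n - 1}. even i}"
      "plus_D n = {i \<in> {1..<n - 1}. odd i}" "plus_AB (n - 1) = {i \<in> {1..<n - 1}. odd i}"
      using False assms by (rule_tac [!] set_eqI) (simp_all add: plus_D_def plus_AB_def, presburger+)
    then show ?thesis
      unfolding coxeter_elt_def
      using last[of "{i \<in> {1..<n - 1}. even i}"] others[of "{i \<in> {1..<n - 1}. odd i}"]
      by simp
  qed
qed

section \<open>Orbits as closures under the simple reflections\<close>

lemma group_orbit_eqI:
  assumes "v \<in> X" "\<And>i x. i \<in> {1..n} \<Longrightarrow> x \<in> X \<Longrightarrow> s i x \<in> X"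
    and "\<And>x. x \<in> X \<Longrightarrow> (\<And>i y. i \<in> {1..n} \<Longrightarrow> y \<in> group_orbit s n v \<Longrightarrow> s i y \<in> group_orbit s n v) \<Longrightarrow>
      v \<in> group_orbit s n v \<Longrightarrow> x \<in> group_orbit s n v"
  shows "group_orbit s n v = X"
proof (intro equalityI subsetI)
  fix x assume "x \<in> group_orbit s n v"
  then obtain w where "w \<in> refl_group s n" "x = w v" unfolding group_orbit_def by blast
  then show "x \<in> X"
  proof (induction arbitrary: x)
    case id
    then show ?case using assms(1) by simp
  next
    case (step w i)
    then show ?case using assms(2) by simp
  qed
next
  fix x assume "x \<in> X"
  then show "x \<in> group_orbit s n v"
  proof (rule assms(3))
    show "v \<in> group_orbit s n v"
      unfolding group_orbit_def by (metis (mono_tags) id_apply mem_Collect_eq refl_group.id)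
    fix i y assume i: "i \<in> {1..n}" and "y \<in> group_orbit s n v"
    then obtain w where "w \<in> refl_group s n" "y = w v" unfolding group_orbit_def by blast
    then have "s i \<circ> w \<in> refl_group s n" "s i y = (s i \<circ> w) v"
      using i by (auto intro: refl_group.step)
    then show "s i y \<in> group_orbit s n v" unfolding group_orbit_def by blast
  qed
qed

section \<open>The Coxeter planes of the three types\<close>

lemma lin_map_reflection:
  assumes "std_basis e M" and "\<And>k. k \<in> {1..M} \<Longrightarrow> f k = e k - (2 * (\<beta> \<bullet> e k)) *\<^sub>R \<beta>"
  shows "lin_map e M f x = x - (2 * (\<beta> \<bullet> x)) *\<^sub>R \<beta>"
proof -
  have "linear (\<lambda>x. x - (2 * (\<beta> \<bullet> x)) *\<^sub>R \<beta>)"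
    by (intro linearI) (simp_all add: inner_add_right scaleR_diff_right algebra_simps)
  then have "lin_map e M f = (\<lambda>x. x - (2 * (\<beta> \<bullet> x)) *\<^sub>R \<beta>)"
    using assms by (intro linear_eq_std_basis[OF assms(1) linear_lin_map]) (simp_all add: lin_map_basis)
  then show ?thesis by simp
qed

lemma reflection_fixed_iff:
  fixes \<beta> x :: "'a::euclidean_space"
  assumes "norm \<beta> = 1"
  shows "x - (2 * (\<beta> \<bullet> x)) *\<^sub>R \<beta> = x \<longleftrightarrow> \<beta> \<bullet> x = 0"
  using assms by auto

lemma half_sqrt2: "(2 * (1 / sqrt 2)) *\<^sub>R (1 / sqrt 2) *\<^sub>R x = (x :: 'a::real_vector)"
  by simp

lemma path_root_inner:
  assumes "std_basis e M" "j \<in> {1..<M}" "k \<in> {1..M}"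
  shows "path_root e j \<bullet> e k = (if k = j then 1 / sqrt 2 else if k = j + 1 then - (1 / sqrt 2) else 0)"
  using assms by (auto simp: path_root_def inner_diff_left std_basis_inner[OF assms(1)])

lemma norm_path_root:
  assumes "std_basis e M" "j \<in> {1..<M}"
  shows "norm (path_root e j) = 1"
proof -
  have "path_root e j \<bullet> path_root e j = 1"
    using assms by (simp add: path_root_def inner_diff_left inner_diff_right std_basis_inner[OF assms(1)])
  then show ?thesis by (simp add: norm_eq_1)
qed

lemma path_root_neighbour:
  assumes "std_basis e M" "j \<ge> 1" "j + 2 \<le> M"
  shows "path_root e j \<bullet> path_root e (j + 1) < 0"
  using assms by (simp add: path_root_def inner_diff_left inner_diff_right std_basis_inner[OF assms(1)])

lemma lin_map_transpose:
  assumes "std_basis e M" "j \<in> {1..<M}"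
  shows "lin_map e M (\<lambda>k. e (Transposition.transpose j (j + 1) k)) x
    = x - (2 * (path_root e j \<bullet> x)) *\<^sub>R path_root e j"
proof (rule lin_map_reflection[OF assms(1)])
  fix k assume k: "k \<in> {1..M}"
  have "path_root e j \<bullet> e k = (if k = j then 1 / sqrt 2 else if k = j + 1 then - (1 / sqrt 2) else 0)"
    by (rule path_root_inner[OF assms k])
  then show "e (Transposition.transpose j (j + 1) k) = e k - (2 * (path_root e j \<bullet> e k)) *\<^sub>R path_root e j"
    by (auto simp: path_root_def half_sqrt2 Transposition.transpose_def)
qed

text \<open>Orthogonality to the path roots makes all coordinates equal. In each type one further
  condition forces the common value to be zero: the coordinate sum in type A, the last root in types
  B and D.\<close>

lemma path_root_total:
  assumes "M \<ge> 1" "\<And>j. j \<in> {1..<M} \<Longrightarrow> path_root e j \<bullet> x = 0" "i \<in> {1..M}"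
  shows "x \<bullet> e i = x \<bullet> e M"
proof -
  have "i \<le> M" "1 \<le> i" using assms(3) by auto
  then show ?thesis
  proof (induction rule: inc_induct)
    case (step k)
    then have "path_root e k \<bullet> x = 0" by (intro assms(2)) auto
    then have "x \<bullet> e k = x \<bullet> e (Suc k)"
      by (simp add: path_root_def inner_commute[of _ x] inner_diff_right)
    then show ?case using step by simp
  qed simp
qed

text \<open>Connectedness of a path, which is the whole diagram in types A and B and the diagram
  without the fork vertex \<open>n\<close> in type D.\<close>

lemma nat_interval_connected:
  fixes Z :: "nat set"
  assumes "Z \<subseteq> {1..n}" "Z \<noteq> {}"
    and up: "\<And>i. i \<in> Z \<Longrightarrow> i + 1 \<le> n \<Longrightarrow> i + 1 \<in> Z"
    and down: "\<And>i. i + 1 \<in> Z \<Longrightarrow> 1 \<le> i \<Longrightarrow> i \<in> Z"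
  shows "Z = {1..n}"
proof -
  obtain z where z: "z \<in> Z" "1 \<le> z" "z \<le> n" using assms(1,2) by force
  have "i \<in> Z" if "z \<le> i" "i \<le> n" for i
    using that
  proof (induction rule: dec_induct)
    case (step k)
    then show ?case using up[of k] by simp
  qed (rule z)
  moreover have "i \<in> Z" if "i \<le> z" "1 \<le> i" for i
    using that
  proof (induction rule: inc_induct)
    case (step k)
    then show ?case using down[of k] by simp
  qed (rule z)
  ultimately have "i \<in> Z" if "i \<in> {1..n}" for i
    using that by (cases "z \<le> i") auto
  then have "{1..n} \<subseteq> Z" by blast
  then show ?thesis using assms(1) by blast
qed

lemma sin_half_angle_pos:
  assumes "N \<ge> 3"
  shows "sin (pi / (2 * real N)) > 0" "cos (pi / (2 * real N)) > 0"
proof -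
  have "0 < pi / (2 * real N)" "pi / (2 * real N) < pi / 2"
    using assms by (auto simp: field_simps)
  then show "sin (pi / (2 * real N)) > 0" "cos (pi / (2 * real N)) > 0"
    by (auto intro: sin_gt_zero cos_gt_zero)
qed

lemma cos_vec_path_root_pos:
  assumes "std_basis e M" "m \<le> M" "N \<ge> 3" "j \<ge> 1" "j < m" "m \<le> N"
  shows "cos_vec e N m \<bullet> path_root e j > 0"
proof -
  have "0 < real j * pi / real N" "real j * pi / real N < pi"
    using assms by (auto simp: field_simps)
  then have "sin (real j * pi / real N) > 0" by (rule sin_gt_zero)
  then show ?thesis
    using sin_half_angle_pos[OF assms(3)] by (simp add: cos_vec_path_root[OF assms(1-5)])
qed

text \<open>The common factor \<open>sin (j * pi / N)\<close> cancels and leaves the cotangent of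
  \<open>pi / (2 * N)\<close>, the constant \<open>K\<close> for
  \<open>coxeter_plane_eq_span\<close> in all three types.\<close>

lemma sin_vec_path_root_eq:
  assumes "std_basis e M" "m \<le> M" "N \<ge> 3" "j \<ge> 1" "j < m"
  shows "sin_vec e N m \<bullet> path_root e j = cos (pi / (2 * real N)) / sin (pi / (2 * real N))
    * (if odd j then cos_vec e N m \<bullet> path_root e j else - (cos_vec e N m \<bullet> path_root e j))"
  using sin_half_angle_pos[OF assms(3)]
  by (simp add: cos_vec_path_root[OF assms] sin_vec_path_root[OF assms])

text \<open>The last angle before the flip is the complement of \<open>pi / (2 * N)\<close>; this
  evaluates the products with the roots at the end of the diagram in types B and D.\<close>

lemma vertex_angle_middle:
  assumes "m \<ge> 1"
  shows "cos (vertex_angle (2 * m) m) = sin (pi / (2 * real (2 * m)))"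
    and "sin (vertex_angle (2 * m) m) = cos (pi / (2 * real (2 * m)))"
proof -
  have "vertex_angle (2 * m) m = pi / 2 - pi / (2 * real (2 * m))"
    using assms by (simp add: vertex_angle_def field_simps)
  then show "cos (vertex_angle (2 * m) m) = sin (pi / (2 * real (2 * m)))"
    "sin (vertex_angle (2 * m) m) = cos (pi / (2 * real (2 * m)))"
    by (simp_all only: cos_diff sin_diff cos_pi_half sin_pi_half mult_zero_left mult_1 add_0 diff_zero)
qed

lemma coxeter_plane_A:
  assumes "n \<ge> 2" and e: "std_basis e (n + 1)"
    and P: "is_coxeter_plane (sum_zero e n) n (simple_refl_A e n) (plus_AB n) P"
  shows "P = span {cos_vec e (n + 1) (n + 1), sin_vec e (n + 1) (n + 1)}"
proof -
  define N where "N = n + 1"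
  have N: "N \<ge> 3" using assms(1) by (simp add: N_def)
  have eN: "std_basis e N" using e by (simp add: N_def)
  note trig = sin_half_angle_pos[OF N]
  define x where "x = pi / (2 * real N)"
  have ang: "vertex_angle N i = (2 * real i - 1) * x" for i
    by (simp add: vertex_angle_def x_def)
  \<comment> \<open>The telescoping sums are taken at half the angle used for the norms; their
    vanishing places both vectors in the sum-zero hyperplane.\<close>
  have "2 * real N * x = pi" using N by (simp add: x_def)
  then have sums: "(\<Sum>i = 1..N. cos (vertex_angle N i)) = 0"
      "(\<Sum>i = 1..N. (-1) ^ i * sin (vertex_angle N i)) = 0"
    using sum_cos_odd_multiples[of x N] sum_alternating_sin_odd_multiples[of x N] trig
    by (simp_all add: ang x_def[symmetric])
  have "P = span {cos_vec e N N, sin_vec e N N}"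
  proof (rule coxeter_plane_eq_span[where \<beta> = "path_root e", OF _ _ plus_AB_subset _ _ _ _ _ _ _ _ _ P])
    show "subspace (sum_zero e n)"
      unfolding subspace_def sum_zero_def
      by (auto simp: inner_add_left sum.distrib simp flip: sum_distrib_left distrib_left)
    show "n \<ge> 1" using assms(1) by simp
    fix i assume i: "i \<in> {1..n}"
    then have j: "i \<in> {1..<N}" by (auto simp: N_def)
    have "path_root e i \<bullet> e k = (if k = i then 1 / sqrt 2 else 0) - (if k = i + 1 then 1 / sqrt 2 else 0)"
      if "k \<in> {1..N}" for k
      using path_root_inner[OF eN j that] by simp
    then have "(\<Sum>k = 1..N. path_root e i \<bullet> e k)
        = (\<Sum>k = 1..N. (if k = i then 1 / sqrt 2 else 0) - (if k = i + 1 then 1 / sqrt 2 else 0))"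
      by (intro sum.cong refl)
    also have "\<dots> = 0"
      using j by (simp add: sum_subtractf)
    finally have "path_root e i \<in> sum_zero e n"
      by (simp add: sum_zero_def N_def)
    moreover have "simple_refl_A e n i x = x \<longleftrightarrow> path_root e i \<bullet> x = 0" for x
      using lin_map_transpose[OF eN j] reflection_fixed_iff[OF norm_path_root[OF eN j]]
      by (simp add: simple_refl_A_def N_def)
    ultimately show "path_root e i \<in> sum_zero e n \<and> norm (path_root e i) = 1
      \<and> {x \<in> sum_zero e n. simple_refl_A e n i x = x} = {x \<in> sum_zero e n. path_root e i \<bullet> x = 0}"
      using norm_path_root[OF eN j] by simp
    show "cos_vec e N N \<bullet> path_root e i > 0"
      using j by (intro cos_vec_path_root_pos[OF eN _ N]) auto
    show "sin_vec e N N \<bullet> path_root e i = cos (pi / (2 * real N)) / sin (pi / (2 * real N))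
      * (if i \<in> plus_AB n then cos_vec e N N \<bullet> path_root e i else - (cos_vec e N N \<bullet> path_root e i))"
    proof -
      have "i \<in> plus_AB n \<longleftrightarrow> odd i" using i by (simp add: plus_AB_def)
      then show ?thesis
        using j by (simp only:) (rule sin_vec_path_root_eq[OF eN _ N]; simp)
    qed
  next
    fix Z assume Z: "Z \<subseteq> {1..n}" "Z \<noteq> {}"
      "\<And>i j. i \<in> Z \<Longrightarrow> j \<in> {1..n} \<Longrightarrow> path_root e i \<bullet> path_root e j < 0 \<Longrightarrow> j \<in> Z"
    show "Z = {1..n}"
    proof (rule nat_interval_connected[OF Z(1,2)])
      fix i assume "i \<in> Z" "i + 1 \<le> n"
      then show "i + 1 \<in> Z"
        using path_root_neighbour[OF eN, of i] Z(1) Z(3)[of i "i + 1"] by (auto simp: N_def)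
    next
      fix i assume "i + 1 \<in> Z" "1 \<le> i"
      then show "i \<in> Z"
        using path_root_neighbour[OF eN, of i] Z(1) Z(3)[of "i + 1" i] by (auto simp: N_def inner_commute)
    qed
  next
    fix x assume x: "x \<in> sum_zero e n" "\<And>i. i \<in> {1..n} \<Longrightarrow> path_root e i \<bullet> x = 0"
    have eq: "x \<bullet> e i = x \<bullet> e N" if "i \<in> {1..N}" for i
      using x(2) N by (intro path_root_total[OF _ _ that]) (auto simp: N_def)
    then have "(\<Sum>i = 1..N. x \<bullet> e i) = (\<Sum>i = 1..N. x \<bullet> e N)"
      by (intro sum.cong refl)
    also have "\<dots> = real N * (x \<bullet> e N)" by simp
    finally have "x \<bullet> e N = 0"
      using x(1) N by (simp add: sum_zero_def N_def)
    then show "x = 0" using eq by (intro std_basis_eq_0[OF eN]) simp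
  next
    have "(\<Sum>i = 1..N. cos_vec e N N \<bullet> e i) = (\<Sum>i = 1..N. cos (vertex_angle N i))"
      by (intro sum.cong refl) (simp add: cos_vec_inner[OF eN])
    then show "cos_vec e N N \<in> sum_zero e n"
      using sums by (simp add: sum_zero_def N_def)
    have "(\<Sum>i = 1..N. sin_vec e N N \<bullet> e i) = - (\<Sum>i = 1..N. (-1) ^ i * sin (vertex_angle N i))"
      unfolding sum_negf[symmetric]
      by (intro sum.cong refl) (simp add: sin_vec_inner[OF eN])
    then show "sin_vec e N N \<in> sum_zero e n"
      using sums by (simp add: sum_zero_def N_def)
    show "(\<Sum>i = 1..n. (cos_vec e N N \<bullet> path_root e i) *\<^sub>R path_root e i)
        = (2 * (sin (pi / (2 * real N)))\<^sup>2) *\<^sub>R cos_vec e N N"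
      using sum_cos_vec_path_root[OF eN _ N, of N] N by (simp add: N_def)
    show "cos (pi / (2 * real N)) / sin (pi / (2 * real N)) \<noteq> 0"
      using trig by simp
  qed
  then show ?thesis by (simp add: N_def)
qed

lemma coxeter_plane_B:
  assumes "n \<ge> 2" and e: "std_basis e n"
    and P: "is_coxeter_plane UNIV n (simple_refl_B e n) (plus_AB n) P"
  shows "P = span {cos_vec e (2 * n) n, sin_vec e (2 * n) n}"
proof -
  define N where "N = 2 * n"
  define \<beta> where "\<beta> i = (if i < n then path_root e i else e n)" for i
  have N: "N \<ge> 3" using assms(1) by (simp add: N_def)
  note trig = sin_half_angle_pos[OF N]
  have n: "n \<in> {1..n}" using assms(1) by simp
  have last: "cos_vec e N n \<bullet> e n = sin (pi / (2 * real N))"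
    "sin_vec e N n \<bullet> e n = - ((-1) ^ n) * cos (pi / (2 * real N))"
    using assms(1) vertex_angle_middle[of n]
    by (simp_all add: cos_vec_inner[OF e] sin_vec_inner[OF e] N_def)
  have neighbour: "\<beta> i \<bullet> \<beta> (i + 1) < 0" if "1 \<le> i" "i + 1 \<le> n" for i
  proof (cases "i + 1 = n")
    case True
    then show ?thesis
      using that path_root_inner[OF e, of i n] by (auto simp: \<beta>_def)
  next
    case False
    then show ?thesis
      using that path_root_neighbour[OF e, of i] by (simp add: \<beta>_def)
  qed
  have "P = span {cos_vec e N n, sin_vec e N n}"
  proof (rule coxeter_plane_eq_span[where \<beta> = \<beta>, OF subspace_UNIV _ plus_AB_subset _ _ _ UNIV_I UNIV_I _ _ _ _ P])
    show "n \<ge> 1" using assms(1) by simp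
    fix i assume i: "i \<in> {1..n}"
    have norm: "norm (\<beta> i) = 1"
      using i norm_path_root[OF e, of i] std_basis_inner[OF e n n] by (simp add: \<beta>_def norm_eq_1)
    have "simple_refl_B e n i x = x - (2 * (\<beta> i \<bullet> x)) *\<^sub>R \<beta> i" for x
    proof (cases "i < n")
      case True
      then show ?thesis
        using i lin_map_transpose[OF e, of i] by (simp add: simple_refl_B_def \<beta>_def)
    next
      case False
      have "lin_map e n (\<lambda>j. if j = n then - e n else e j) x = x - (2 * (e n \<bullet> x)) *\<^sub>R e n"
        by (rule lin_map_reflection[OF e]) (use std_basis_inner[OF e n] in \<open>auto simp: scaleR_2\<close>)
      then show ?thesis
        using False by (simp add: simple_refl_B_def \<beta>_def)
    qed
    then show "\<beta> i \<in> UNIV \<and> norm (\<beta> i) = 1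
      \<and> {x \<in> UNIV. simple_refl_B e n i x = x} = {x \<in> UNIV. \<beta> i \<bullet> x = 0}"
      using norm reflection_fixed_iff[OF norm] by simp
    show "cos_vec e N n \<bullet> \<beta> i > 0"
      using i last trig cos_vec_path_root_pos[OF e _ N, of n i] by (simp add: \<beta>_def N_def)
    show "sin_vec e N n \<bullet> \<beta> i = cos (pi / (2 * real N)) / sin (pi / (2 * real N))
      * (if i \<in> plus_AB n then cos_vec e N n \<bullet> \<beta> i else - (cos_vec e N n \<bullet> \<beta> i))"
    proof (cases "i < n")
      case True
      then have "i \<in> plus_AB n \<longleftrightarrow> odd i" "\<beta> i = path_root e i"
        using i by (auto simp: plus_AB_def \<beta>_def)
      then show ?thesis
        using i True by (simp only:) (rule sin_vec_path_root_eq[OF e _ N]; simp)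
    next
      case False
      then show ?thesis
        using i last trig by (auto simp: \<beta>_def plus_AB_def)
    qed
  next
    fix Z assume Z: "Z \<subseteq> {1..n}" "Z \<noteq> {}"
      "\<And>i j. i \<in> Z \<Longrightarrow> j \<in> {1..n} \<Longrightarrow> \<beta> i \<bullet> \<beta> j < 0 \<Longrightarrow> j \<in> Z"
    show "Z = {1..n}"
    proof (rule nat_interval_connected[OF Z(1,2)])
      fix i assume "i \<in> Z" "i + 1 \<le> n"
      then show "i + 1 \<in> Z"
        using neighbour[of i] Z(1) Z(3)[of i "i + 1"] by auto
    next
      fix i assume "i + 1 \<in> Z" "1 \<le> i"
      then show "i \<in> Z"
        using neighbour[of i] Z(1) Z(3)[of "i + 1" i] by (auto simp: inner_commute)
    qed
  next
    fix x assume x: "\<And>i. i \<in> {1..n} \<Longrightarrow> \<beta> i \<bullet> x = 0"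
    have "path_root e j \<bullet> x = 0" if "j \<in> {1..<n}" for j
      using x[of j] that by (simp add: \<beta>_def)
    then have "x \<bullet> e i = x \<bullet> e n" if "i \<in> {1..n}" for i
      using assms(1) by (intro path_root_total[OF _ _ that]) auto
    moreover have "x \<bullet> e n = 0"
      using x[OF n] by (simp add: \<beta>_def inner_commute)
    ultimately show "x = 0" by (intro std_basis_eq_0[OF e]) simp
  next
    have "(\<Sum>i = 1..n. (cos_vec e N n \<bullet> \<beta> i) *\<^sub>R \<beta> i)
        = (\<Sum>i = 1..n - 1. (cos_vec e N n \<bullet> \<beta> i) *\<^sub>R \<beta> i) + (cos_vec e N n \<bullet> \<beta> n) *\<^sub>R \<beta> n"
      using assms(1) by (cases n) simp_all
    also have "(\<Sum>i = 1..n - 1. (cos_vec e N n \<bullet> \<beta> i) *\<^sub>R \<beta> i)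
        = (\<Sum>i = 1..n - 1. (cos_vec e N n \<bullet> path_root e i) *\<^sub>R path_root e i)"
      by (intro sum.cong refl) (auto simp: \<beta>_def)
    also have "\<dots> = (2 * (sin (pi / (2 * real N)))\<^sup>2) *\<^sub>R cos_vec e N n - sin (pi / (2 * real N)) *\<^sub>R e n"
      using sum_cos_vec_path_root[OF e _ N, of n] assms(1) by (simp add: N_def)
    \<comment> \<open>The last root \<open>e n\<close> has inner product
      \<open>sin (pi / (2 * N))\<close> with \<open>cos_vec\<close>, which cancels the boundary
      term.\<close>
    finally show "(\<Sum>i = 1..n. (cos_vec e N n \<bullet> \<beta> i) *\<^sub>R \<beta> i)
        = (2 * (sin (pi / (2 * real N)))\<^sup>2) *\<^sub>R cos_vec e N n"
      by (simp add: \<beta>_def last)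
    show "cos (pi / (2 * real N)) / sin (pi / (2 * real N)) \<noteq> 0"
      using trig by simp
  qed
  then show ?thesis by (simp add: N_def)
qed

lemma coxeter_plane_D:
  assumes "n \<ge> 4" and e: "std_basis e n"
    and P: "is_coxeter_plane UNIV n (simple_refl_D e n) (plus_D n) P"
  shows "P = span {cos_vec e (2 * (n - 1)) (n - 1), sin_vec e (2 * (n - 1)) (n - 1)}"
proof -
  define m where "m = n - 1"
  define N where "N = 2 * m"
  define \<beta> where "\<beta> i = (if i < n then path_root e i else (1 / sqrt 2) *\<^sub>R (e m + e n))" for i
  have n: "n = m + 1" and m: "m \<ge> 3" using assms(1) by (simp_all add: m_def)
  have N: "N \<ge> 3" using m by (simp add: N_def)
  have mn: "m \<in> {1..n}" "n \<in> {1..n}" "m \<le> n" "m \<noteq> n" using m by (auto simp: n)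
  note trig = sin_half_angle_pos[OF N]
  define S where "S = sin (pi / (2 * real N))"
  have S: "S > 0" using trig by (simp add: S_def)
  have coord: "cos_vec e N m \<bullet> e m = S" "cos_vec e N m \<bullet> e n = 0"
    "sin_vec e N m \<bullet> e m = - ((-1) ^ m) * cos (pi / (2 * real N))" "sin_vec e N m \<bullet> e n = 0"
    using m vertex_angle_middle[of m] mn
    by (simp_all add: cos_vec_inner[OF e mn(3)] sin_vec_inner[OF e mn(3)] N_def S_def n)
  have \<beta>_end: "\<beta> m = (1 / sqrt 2) *\<^sub>R (e m - e n)" "\<beta> n = (1 / sqrt 2) *\<^sub>R (e m + e n)"
    by (simp_all add: \<beta>_def path_root_def n)
  \<comment> \<open>The roots \<open>\<beta> m\<close> and \<open>\<beta> n\<close> differ only in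
    the sign of \<open>e n\<close>, a direction orthogonal to both vectors, so their inner products
    agree. This matches their lying in the same part of the bipartition.\<close>
  have cos_end: "cos_vec e N m \<bullet> \<beta> m = S / sqrt 2" "cos_vec e N m \<bullet> \<beta> n = S / sqrt 2"
    by (simp_all add: \<beta>_end inner_diff_right inner_add_right coord)
  have sin_end: "sin_vec e N m \<bullet> \<beta> i = - ((-1) ^ m) * cos (pi / (2 * real N)) / sqrt 2"
    if "i = m \<or> i = n" for i
    using that by (auto simp: \<beta>_end inner_diff_right inner_add_right coord)
  have neighbour: "\<beta> i \<bullet> \<beta> (i + 1) < 0" if "1 \<le> i" "i + 1 \<le> m" for i
    using that path_root_neighbour[OF e, of i] by (simp add: \<beta>_def n)
  have fork: "\<beta> (m - 1) \<bullet> \<beta> n < 0"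
  proof -
    have "path_root e (m - 1) \<bullet> e m = - (1 / sqrt 2)" "path_root e (m - 1) \<bullet> e n = 0"
      using m by (subst path_root_inner[OF e]; auto simp: n)+
    moreover have "m - 1 < n" by (simp add: n)
    ultimately show ?thesis
      by (simp add: \<beta>_def inner_add_right)
  qed
  have "P = span {cos_vec e N m, sin_vec e N m}"
  proof (rule coxeter_plane_eq_span[where \<beta> = \<beta>, OF subspace_UNIV _ _ _ _ _ UNIV_I UNIV_I _ _ _ _ P])
    show "n \<ge> 1" "plus_D n \<subseteq> {1..n}" using assms(1) by (auto simp: plus_D_def)
    fix i assume i: "i \<in> {1..n}"
    have "\<beta> n \<bullet> \<beta> n = 1"
      using std_basis_inner[OF e] mn
      by (simp add: \<beta>_end inner_add_left inner_add_right)
    then have "norm (\<beta> n) = 1"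
      by (simp only: norm_eq_1)
    moreover have "norm (\<beta> i) = 1" if "i \<noteq> n"
      using that i norm_path_root[OF e, of i] by (simp add: \<beta>_def)
    ultimately have norm: "norm (\<beta> i) = 1" by blast
    have "simple_refl_D e n i x = x - (2 * (\<beta> i \<bullet> x)) *\<^sub>R \<beta> i" for x
    proof (cases "i < n")
      case True
      then show ?thesis
        using i lin_map_transpose[OF e, of i] by (simp add: simple_refl_D_def \<beta>_def)
    next
      case False
      have "lin_map e n (\<lambda>j. if j = m then - e n else if j = n then - e m else e j) x
          = x - (2 * (\<beta> n \<bullet> x)) *\<^sub>R \<beta> n"
      proof (rule lin_map_reflection[OF e])
        fix k assume k: "k \<in> {1..n}"
        have "\<beta> n \<bullet> e k = (if k = m \<or> k = n then 1 / sqrt 2 else 0)"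
          using std_basis_inner[OF e mn(1) k] std_basis_inner[OF e mn(2) k] mn(4)
          by (auto simp: \<beta>_end inner_add_left)
        then show "(if k = m then - e n else if k = n then - e m else e k)
            = e k - (2 * (\<beta> n \<bullet> e k)) *\<^sub>R \<beta> n"
          using mn(4) by (auto simp: \<beta>_end half_sqrt2)
      qed
      then show ?thesis
        unfolding simple_refl_D_def m_def[symmetric] using False i by simp
    qed
    then show "\<beta> i \<in> UNIV \<and> norm (\<beta> i) = 1
      \<and> {x \<in> UNIV. simple_refl_D e n i x = x} = {x \<in> UNIV. \<beta> i \<bullet> x = 0}"
      using norm reflection_fixed_iff[OF norm] by simp
    consider "i < m" | "i = m \<or> i = n" using i n by fastforce
    note cases = this
    show "cos_vec e N m \<bullet> \<beta> i > 0"
    proof (cases rule: cases)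
      case 1
      then show ?thesis
        using i cos_vec_path_root_pos[OF e mn(3) N, of i] by (simp add: \<beta>_def n N_def)
    qed (use cos_end S in auto)
    show "sin_vec e N m \<bullet> \<beta> i = cos (pi / (2 * real N)) / sin (pi / (2 * real N))
      * (if i \<in> plus_D n then cos_vec e N m \<bullet> \<beta> i else - (cos_vec e N m \<bullet> \<beta> i))"
    proof (cases rule: cases)
      case 1
      then have "i \<in> plus_D n \<longleftrightarrow> odd i" "\<beta> i = path_root e i"
        using i by (auto simp: plus_D_def \<beta>_def n)
      then show ?thesis
        using i 1 by (simp only:) (rule sin_vec_path_root_eq[OF e mn(3) N]; simp)
    next
      case 2
      then have "i \<in> plus_D n \<longleftrightarrow> odd m" "cos_vec e N m \<bullet> \<beta> i = S / sqrt 2"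
        using m cos_end by (auto simp: plus_D_def n)
      then show ?thesis
        using S sin_end[OF 2] by (simp add: S_def)
    qed
  next
    fix Z assume Z: "Z \<subseteq> {1..n}" "Z \<noteq> {}"
      "\<And>i j. i \<in> Z \<Longrightarrow> j \<in> {1..n} \<Longrightarrow> \<beta> i \<bullet> \<beta> j < 0 \<Longrightarrow> j \<in> Z"
    have "m - 1 \<in> {1..n}" "\<beta> n \<bullet> \<beta> (m - 1) < 0"
      using m fork by (auto simp: n inner_commute)
    \<comment> \<open>The fork vertex \<open>n\<close> hangs on \<open>m - 1\<close>, so it belongs
      to \<open>Z\<close> exactly when \<open>m - 1\<close> does; what remains is the path from 1 to
      \<open>m\<close>.\<close>
    then have nZ: "n \<in> Z \<longleftrightarrow> m - 1 \<in> Z"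
      using Z(3) fork mn(2) by blast
    have "Z \<inter> {1..m} = {1..m}"
    proof (rule nat_interval_connected)
      show "Z \<inter> {1..m} \<noteq> {}"
      proof (cases "n \<in> Z")
        case True
        then have "m - 1 \<in> Z \<inter> {1..m}" using nZ m by auto
        then show ?thesis by blast
      next
        case False
        obtain z where "z \<in> Z" using Z(2) by blast
        moreover from this have "z \<in> {1..n}" "z \<noteq> n" using Z(1) False by blast+
        then have "z \<in> {1..m}" by (auto simp: n)
        ultimately show ?thesis by blast
      qed
    next
      fix i assume "i \<in> Z \<inter> {1..m}" "i + 1 \<le> m"
      then show "i + 1 \<in> Z \<inter> {1..m}"
        using neighbour[of i] Z(3)[of i "i + 1"] by (auto simp: n)
    next
      fix i assume "i + 1 \<in> Z \<inter> {1..m}" "1 \<le> i"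
      then show "i \<in> Z \<inter> {1..m}"
        using neighbour[of i] Z(3)[of "i + 1" i] by (auto simp: n inner_commute)
    qed simp
    then have sub: "{1..m} \<subseteq> Z" by blast
    moreover have "m - 1 \<in> {1..m}" using m by auto
    then have "n \<in> Z" using sub nZ by blast
    moreover have "{1..n} = insert n {1..m}" by (auto simp: n)
    ultimately show "Z = {1..n}"
      using Z(1) by (metis insert_subset subset_antisym)
  next
    fix x assume x: "\<And>i. i \<in> {1..n} \<Longrightarrow> \<beta> i \<bullet> x = 0"
    have "path_root e j \<bullet> x = 0" if "j \<in> {1..<n}" for j
      using x[of j] that by (simp add: \<beta>_def)
    then have eq: "x \<bullet> e i = x \<bullet> e n" if "i \<in> {1..n}" for i
      using assms(1) by (intro path_root_total[OF _ _ that]) auto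
    have "e m \<bullet> x + e n \<bullet> x = 0"
      using x[OF mn(2)] by (simp add: \<beta>_end inner_add_left)
    then have "x \<bullet> e n = 0"
      using eq[OF mn(1)] by (simp add: inner_commute)
    then show "x = 0" using eq by (intro std_basis_eq_0[OF e]) simp
  next
    have "{1..n} = {1..m - 1} \<union> {m, n}"
      using m by (auto simp: n)
    then have "(\<Sum>i = 1..n. (cos_vec e N m \<bullet> \<beta> i) *\<^sub>R \<beta> i)
        = (\<Sum>i = 1..m - 1. (cos_vec e N m \<bullet> \<beta> i) *\<^sub>R \<beta> i)
          + (\<Sum>i\<in>{m, n}. (cos_vec e N m \<bullet> \<beta> i) *\<^sub>R \<beta> i)"
      using m n by (simp only:) (intro sum.union_disjoint; auto)
    also have "(\<Sum>i\<in>{m, n}. (cos_vec e N m \<bullet> \<beta> i) *\<^sub>R \<beta> i) = (S / sqrt 2) *\<^sub>R (\<beta> m + \<beta> n)"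
      using mn(4) by (simp add: cos_end scaleR_add_right)
    \<comment> \<open>In the sum of the two end roots \<open>e n\<close> drops out, and
      \<open>(S / sqrt 2) * (2 / sqrt 2) = S\<close> is the coefficient that cancels the boundary
      term.\<close>
    also have "\<beta> m + \<beta> n = (2 / sqrt 2) *\<^sub>R e m"
      by (simp add: \<beta>_end scaleR_add_right scaleR_diff_right flip: scaleR_add_left)
    also have "(\<Sum>i = 1..m - 1. (cos_vec e N m \<bullet> \<beta> i) *\<^sub>R \<beta> i)
        = (\<Sum>i = 1..m - 1. (cos_vec e N m \<bullet> path_root e i) *\<^sub>R path_root e i)"
      by (intro sum.cong refl) (auto simp: \<beta>_def n)
    also have "\<dots> = (2 * S\<^sup>2) *\<^sub>R cos_vec e N m - S *\<^sub>R e m"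
      using sum_cos_vec_path_root[OF e mn(3) N] m by (simp add: N_def S_def)
    finally show "(\<Sum>i = 1..n. (cos_vec e N m \<bullet> \<beta> i) *\<^sub>R \<beta> i) = (2 * S\<^sup>2) *\<^sub>R cos_vec e N m"
      by simp
    show "cos (pi / (2 * real N)) / sin (pi / (2 * real N)) \<noteq> 0"
      using trig by simp
  qed
  then show ?thesis by (simp add: N_def m_def)
qed

section \<open>The projected orbits\<close>

text \<open>For \<open>i = 2 * m + 1 - k\<close> the vertex angle is \<open>pi\<close> minus the one
  at \<open>k\<close>, and the parity is opposite. The cosine changes sign by the first fact and the
  signed sine by the second, as the vector \<open>- e k\<close> demands.\<close>

lemma signed_basis_inner:
  assumes e: "std_basis e M" "m \<le> M" and i: "i \<in> {1..2 * m}"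
  shows "cos_vec e (2 * m) m \<bullet> signed_basis e m i = cos (vertex_angle (2 * m) i)"
    and "sin_vec e (2 * m) m \<bullet> signed_basis e m i = - ((-1) ^ i) * sin (vertex_angle (2 * m) i)"
proof -
  have "cos_vec e (2 * m) m \<bullet> signed_basis e m i = cos (vertex_angle (2 * m) i)
    \<and> sin_vec e (2 * m) m \<bullet> signed_basis e m i = - ((-1) ^ i) * sin (vertex_angle (2 * m) i)"
  proof (cases "i \<le> m")
    case True
    then show ?thesis
      using i e(2) by (simp add: signed_basis_def cos_vec_inner[OF e] sin_vec_inner[OF e])
  next
    case False
    define k where "k = 2 * m + 1 - i"
    have k: "k \<in> {1..m}" "signed_basis e m i = - e k" "i = 2 * m + 1 - k"
      using False i by (auto simp: k_def signed_basis_def)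
    have "vertex_angle (2 * m) i = pi - vertex_angle (2 * m) k"
      using k by (simp add: vertex_angle_def of_nat_diff field_simps)
    then have "cos (vertex_angle (2 * m) i) = - cos (vertex_angle (2 * m) k)"
      "sin (vertex_angle (2 * m) i) = sin (vertex_angle (2 * m) k)"
      by (simp_all only: cos_pi_minus sin_pi_minus)
    moreover have "even i \<longleftrightarrow> odd k"
      using k(1,3) by auto
    then have "(-1 :: real) ^ i = - ((-1) ^ k)"
      by (simp add: minus_one_power_iff)
    ultimately show ?thesis
      using k(1,2) e(2) by (simp add: cos_vec_inner[OF e] sin_vec_inner[OF e])
  qed
  then show "cos_vec e (2 * m) m \<bullet> signed_basis e m i = cos (vertex_angle (2 * m) i)"
    "sin_vec e (2 * m) m \<bullet> signed_basis e m i = - ((-1) ^ i) * sin (vertex_angle (2 * m) i)"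
    by blast+
qed

section \<open>Orbits of a coordinate vector\<close>

lemma transpose_in_interval:
  fixes j k n :: nat
  shows "j \<in> {1..<n} \<Longrightarrow> k \<in> {1..n} \<Longrightarrow> Transposition.transpose j (j + 1) k \<in> {1..n}"
  by (auto simp: Transposition.transpose_def)

lemma group_orbit_transpositions:
  assumes "\<And>j k. j \<in> {1..n} \<Longrightarrow> k \<in> {1..n + 1} \<Longrightarrow> s j (e k) = e (Transposition.transpose j (j + 1) k)"
  shows "group_orbit s n (e 1) = e ` {1..n + 1}"
proof (rule group_orbit_eqI)
  show "e 1 \<in> e ` {1..n + 1}" by simp
  show "s j x \<in> e ` {1..n + 1}" if j: "j \<in> {1..n}" and x: "x \<in> e ` {1..n + 1}" for j x
  proof -
    obtain k where k: "k \<in> {1..n + 1}" "x = e k" using x by blast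
    have "Transposition.transpose j (j + 1) k \<in> {1..n + 1}"
      using j by (intro transpose_in_interval[OF _ k(1)]) auto
    then show ?thesis
      by (simp only: k(2) assms[OF j k(1)]) (rule imageI)
  qed
  fix x assume x: "x \<in> e ` {1..n + 1}"
    and closed: "\<And>j y. j \<in> {1..n} \<Longrightarrow> y \<in> group_orbit s n (e 1) \<Longrightarrow> s j y \<in> group_orbit s n (e 1)"
    and base: "e 1 \<in> group_orbit s n (e 1)"
  obtain k where k: "1 \<le> k" "k \<le> n + 1" "x = e k" using x by auto
  from k(1,2) have "e k \<in> group_orbit s n (e 1)"
  proof (induction rule: dec_induct)
    case (step k)
    then show ?case
      using assms[of k k] closed[of k "e k"] by simp
  qed (rule base)
  then show "x \<in> group_orbit s n (e 1)" by (simp add: k(3))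
qed

text \<open>The transpositions reach every \<open>e k\<close>, then \<open>s n\<close> leads from
  \<open>e l\<close> to \<open>- e n\<close>, and the transpositions descend from there to every
  \<open>- e k\<close>. The index \<open>l\<close> is \<open>n\<close> in type B and
  \<open>n - 1\<close> in type D.\<close>

lemma group_orbit_signed_permutations:
  fixes s :: "nat \<Rightarrow> 'a::real_vector \<Rightarrow> 'a"
  assumes "n \<ge> 1" and lin: "\<And>j. j \<in> {1..n} \<Longrightarrow> linear (s j)"
    and s: "\<And>j k. j \<in> {1..<n} \<Longrightarrow> k \<in> {1..n} \<Longrightarrow> s j (e k) = e (Transposition.transpose j (j + 1) k)"
    and s_last: "\<And>k. k \<in> {1..n} \<Longrightarrow> s n (e k) \<in> e ` {1..n} \<union> (\<lambda>i. - e i) ` {1..n}"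
    and neg: "l \<in> {1..n}" "s n (e l) = - e n"
  shows "group_orbit s n (e 1) = e ` {1..n} \<union> (\<lambda>i. - e i) ` {1..n}"
proof (rule group_orbit_eqI)
  let ?X = "e ` {1..n} \<union> (\<lambda>i. - e i) ` {1..n}"
  show "e 1 \<in> ?X" using \<open>n \<ge> 1\<close> by simp
  have neg_X: "- x \<in> ?X" if "x \<in> ?X" for x
    using that by auto
  show "s j x \<in> ?X" if j: "j \<in> {1..n}" and x: "x \<in> ?X" for j x
  proof -
    have e_X: "s j (e k) \<in> ?X" if "k \<in> {1..n}" for k
    proof (cases "j = n")
      case False
      then have "j \<in> {1..<n}" using j by auto
      then show ?thesis
        using s[OF _ that] transpose_in_interval[OF _ that] by auto
    qed (use s_last that in simp)
    obtain k where "k \<in> {1..n}" "x = e k \<or> x = - e k" using x by blast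
    then show ?thesis
      using e_X[of k] neg_X[of "s j (e k)"] linear_neg[OF lin[OF j]] by auto
  qed
  fix x assume x: "x \<in> ?X"
    and closed: "\<And>j y. j \<in> {1..n} \<Longrightarrow> y \<in> group_orbit s n (e 1) \<Longrightarrow> s j y \<in> group_orbit s n (e 1)"
    and base: "e 1 \<in> group_orbit s n (e 1)"
  have pos: "e k \<in> group_orbit s n (e 1)" if "1 \<le> k" "k \<le> n" for k
    using that
  proof (induction rule: dec_induct)
    case (step k)
    then show ?case
      using s[of k k] closed[of k "e k"] by simp
  qed (rule base)
  have "- e k \<in> group_orbit s n (e 1)" if "k \<le> n" "1 \<le> k" for k
    using that
  proof (induction rule: inc_induct)
    case base
    then show ?case
      using pos[of l] neg closed[of n "e l"] by simp
  next
    case (step k)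
    have "s k (- e (Suc k)) = - e k"
      using step linear_neg[OF lin[of k]] s[of k "Suc k"] by simp
    then show ?case
      using step closed[of k "- e (Suc k)"] by simp
  qed
  with pos x show "x \<in> group_orbit s n (e 1)" by auto
qed

lemma regular_polygon_A:
  fixes e :: "nat \<Rightarrow> 'a::euclidean_space"
  assumes n: "n \<ge> 2" and e: "std_basis e (n + 1)"
    and P: "is_coxeter_plane (sum_zero e n) n (simple_refl_A e n) (plus_AB n) P"
  defines "c \<equiv> coxeter_elt (simple_refl_A e n) n (plus_AB n)"
  shows "group_orbit (simple_refl_A e n) n (e 1) = e ` {1..n + 1}"
    and "coxeter_number (simple_refl_A e n) n (plus_AB n) = n + 1"
    and "regular_polygon P (n + 1) (orth_proj P ` e ` {1..n + 1})"
    and "cyclic_on c (e ` {1..n + 1})"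
    and "\<And>i. i \<in> {1..n + 1} \<Longrightarrow> regular_polygon_seq P (n + 1) (\<lambda>k. orth_proj P ((c ^^ k) (e i)))"
proof -
  let ?u = "cos_vec e (n + 1) (n + 1)" and ?v = "sin_vec e (n + 1) (n + 1)"
  have s: "simple_refl_A e n j (e k) = e (Transposition.transpose j (j + 1) k)"
    if "k \<in> {1..n + 1}" for j k
    by (simp only: simple_refl_A_def lin_map_basis[OF e that])
  interpret cycled_polygon "n + 1" "real (n + 1) / 2" ?u ?v e c
  proof
    show "?u \<bullet> ?u = real (n + 1) / 2" "?v \<bullet> ?v = real (n + 1) / 2" "?u \<bullet> ?v = 0"
      using n by (intro cos_vec_sin_vec_inner[OF e order_refl _ dvd_triv_right]; simp)+
    show "?u \<bullet> e i = cos (vertex_angle (n + 1) i)"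
      "?v \<bullet> e i = - ((-1) ^ i) * sin (vertex_angle (n + 1) i)" if "i \<in> {1..n + 1}" for i
      using that cos_vec_inner[OF e order_refl that] sin_vec_inner[OF e order_refl that] by simp_all
    show "c (e i) = e (even_step (n + 1) (odd_step (n + 1) i))" if "i \<in> {1..n + 1}" for i
      unfolding c_def by (rule coxeter_elt_A[OF _ that]) (rule s)
  qed (use n in auto)
  have "linear c"
    unfolding c_def simple_refl_A_def by (intro linear_coxeter_elt linear_lin_map plus_AB_subset)
  moreover have "(c ^^ (n + 1)) (e i) = id (e i)" if "i \<in> {1..n + 1}" for i
    using funpow_f_eq_iff[OF that, of "n + 1"] by (metis dvd_refl id_apply)
  ultimately have "c ^^ (n + 1) = id"
    by (intro linear_eq_std_basis[OF e linear_funpow linear_id])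
  then show "coxeter_number (simple_refl_A e n) n (plus_AB n) = n + 1"
    unfolding coxeter_number_def c_def[symmetric] by (rule Least_funpow_eq_id)
  show "group_orbit (simple_refl_A e n) n (e 1) = e ` {1..n + 1}"
    by (rule group_orbit_transpositions) (rule s)
  have "P = span {?u, ?v}"
    by (rule coxeter_plane_A[OF n e P])
  then show "regular_polygon P (n + 1) (orth_proj P ` e ` {1..n + 1})"
    "\<And>i. i \<in> {1..n + 1} \<Longrightarrow> regular_polygon_seq P (n + 1) (\<lambda>k. orth_proj P ((c ^^ k) (e i)))"
    using regular_polygon_image regular_polygon_seq_funpow by simp_all
  show "cyclic_on c (e ` {1..n + 1})"
    by (rule cyclic_on_image)
qed

lemma cycled_polygon_signed_basis:
  assumes e: "std_basis e M" "m \<le> M" and m: "m \<ge> 2"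
    and c: "\<And>i. i \<in> {1..2 * m} \<Longrightarrow>
      c (signed_basis e m i) = signed_basis e m (even_step (2 * m) (odd_step (2 * m) i))"
  shows "cycled_polygon (2 * m) (real m / 2) (cos_vec e (2 * m) m) (sin_vec e (2 * m) m) (signed_basis e m) c"
proof
  show "cos_vec e (2 * m) m \<bullet> cos_vec e (2 * m) m = real m / 2"
    "sin_vec e (2 * m) m \<bullet> sin_vec e (2 * m) m = real m / 2"
    "cos_vec e (2 * m) m \<bullet> sin_vec e (2 * m) m = 0"
    using m by (intro cos_vec_sin_vec_inner[OF e]; simp)+
qed (use m c signed_basis_inner[OF e] in auto)

lemma regular_polygon_B:
  fixes e :: "nat \<Rightarrow> 'a::euclidean_space"
  assumes n: "n \<ge> 2" and e: "std_basis e n"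
    and P: "is_coxeter_plane UNIV n (simple_refl_B e n) (plus_AB n) P"
  shows "group_orbit (simple_refl_B e n) n (e 1) = e ` {1..n} \<union> (\<lambda>i. - e i) ` {1..n}"
    and "coxeter_number (simple_refl_B e n) n (plus_AB n) = 2 * n"
    and "regular_polygon P (2 * n) (orth_proj P ` (e ` {1..n} \<union> (\<lambda>i. - e i) ` {1..n}))"
proof -
  let ?s = "simple_refl_B e n"
  define c where "c = coxeter_elt ?s n (plus_AB n)"
  have lin: "linear (?s j)" for j
    by (simp add: simple_refl_B_def linear_lin_map)
  have s: "?s j (e k) = e (Transposition.transpose j (j + 1) k)" if "k \<in> {1..n}" "j \<in> {1..<n}" for j k
    using that by (simp add: simple_refl_B_def lin_map_basis[OF e])
  have s_last: "?s n (e k) = (if k = n then - e n else e k)" if "k \<in> {1..n}" for k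
    using that by (simp add: simple_refl_B_def lin_map_basis[OF e])
  interpret cycled_polygon "2 * n" "real n / 2" "cos_vec e (2 * n) n" "sin_vec e (2 * n) n" "signed_basis e n" c
  proof (rule cycled_polygon_signed_basis[OF e order_refl n])
    show "c (signed_basis e n i) = signed_basis e n (even_step (2 * n) (odd_step (2 * n) i))"
      if "i \<in> {1..2 * n}" for i
      unfolding c_def by (rule coxeter_elt_B[OF lin _ _ _ that]) (use n s s_last in auto)
  qed
  have "linear c"
    unfolding c_def by (intro linear_coxeter_elt lin plus_AB_subset)
  then have "c ^^ (2 * n) = id"
  proof (intro linear_eq_std_basis[OF e linear_funpow linear_id])
    fix i assume i: "i \<in> {1..n}"
    then have "(c ^^ (2 * n)) (signed_basis e n i) = signed_basis e n i"
      by (subst funpow_f_eq_iff) auto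
    then show "(c ^^ (2 * n)) (e i) = id (e i)"
      using i by (simp add: signed_basis_def)
  qed
  then show "coxeter_number ?s n (plus_AB n) = 2 * n"
    unfolding coxeter_number_def c_def[symmetric] by (rule Least_funpow_eq_id)
  show "group_orbit ?s n (e 1) = e ` {1..n} \<union> (\<lambda>i. - e i) ` {1..n}"
    by (rule group_orbit_signed_permutations[where l = n]) (use n lin s s_last in auto)
  have "P = span {cos_vec e (2 * n) n, sin_vec e (2 * n) n}"
    by (rule coxeter_plane_B[OF n e P])
  then show "regular_polygon P (2 * n) (orth_proj P ` (e ` {1..n} \<union> (\<lambda>i. - e i) ` {1..n}))"
    using regular_polygon_image by (simp only: signed_basis_image)
qed

lemma regular_polygon_D:
  fixes e :: "nat \<Rightarrow> 'a::euclidean_space"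
  assumes n: "n \<ge> 4" and e: "std_basis e n"
    and P: "is_coxeter_plane UNIV n (simple_refl_D e n) (plus_D n) P"
  shows "group_orbit (simple_refl_D e n) n (e 1) = e ` {1..n} \<union> (\<lambda>i. - e i) ` {1..n}"
    and "orth_proj P (e n) = 0" "orth_proj P (- e n) = 0"
    and "coxeter_number (simple_refl_D e n) n (plus_D n) = 2 * n - 2"
    and "regular_polygon P (2 * n - 2) (orth_proj P ` (e ` {1..n - 1} \<union> (\<lambda>i. - e i) ` {1..n - 1}))"
proof -
  let ?s = "simple_refl_D e n"
  define m where "m = n - 1"
  have m: "m \<ge> 2" "m \<le> n" "n = m + 1" using n by (simp_all add: m_def)
  let ?u = "cos_vec e (2 * m) m" and ?v = "sin_vec e (2 * m) m"
  define s' where "s' = ?s(m := ?s m \<circ> ?s n)"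
  define c where "c = coxeter_elt ?s n (plus_D n)"
  have c: "c = coxeter_elt s' m (plus_AB m)"
    unfolding c_def s'_def m_def using n by (intro coxeter_elt_D) simp
  have lin: "linear (?s j)" for j
    by (simp add: simple_refl_D_def linear_lin_map)
  have lin': "linear (s' j)" for j
    using lin by (auto simp: s'_def intro: linear_compose)
  have s: "?s j (e k) = e (Transposition.transpose j (j + 1) k)" if "k \<in> {1..n}" "j \<in> {1..<n}" for j k
    using that by (simp add: simple_refl_D_def lin_map_basis[OF e])
  have s_last: "?s n (e k) = (if k = m then - e n else if k = n then - e m else e k)"
    if "k \<in> {1..n}" for k
    using that unfolding simple_refl_D_def m_def by (simp add: lin_map_basis[OF e])
  \<comment> \<open>After \<open>s n\<close>, which exchanges \<open>e m\<close> and
    \<open>- e n\<close>, the transposition of \<open>m\<close> and \<open>n\<close> leaves both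
    vectors negated; on the first \<open>m\<close> coordinates this is the last reflection of type
    B.\<close>
  have s'_m: "s' m (e k) = (if k < m then e k else - e k)" if "k \<in> {1..n}" for k
  proof -
    have "k < m \<or> k = m \<or> k = n" using that m(3) by auto
    then consider "k < m" | "k = m" | "k = n" by blast
    then show ?thesis
    proof cases
      case 1
      then show ?thesis
        using that m s_last[of k] s[of k m] by (auto simp: s'_def Transposition.transpose_def)
    next
      case 2
      then show ?thesis
        using that m s_last[of k] s[of n m] linear_neg[OF lin[of m]] by (auto simp: s'_def Transposition.transpose_def)
    next
      case 3
      then show ?thesis
        using that m s_last[of k] s[of m m] linear_neg[OF lin[of m]] by (auto simp: s'_def Transposition.transpose_def)
    qed
  qed
  have s'_j: "s' j (e k) = e (Transposition.transpose j (j + 1) k)" if "k \<in> {1..n}" "j \<in> {1..<m}" for j k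
    using that s[of k j] m by (simp add: s'_def)
  interpret cycled_polygon "2 * m" "real m / 2" ?u ?v "signed_basis e m" c
  proof (rule cycled_polygon_signed_basis[OF e m(2,1)])
    show "c (signed_basis e m i) = signed_basis e m (even_step (2 * m) (odd_step (2 * m) i))"
      if "i \<in> {1..2 * m}" for i
      unfolding c by (rule coxeter_elt_B[OF lin' _ _ _ that]) (use m s'_j s'_m in auto)
  qed
  have lin_c: "linear c"
    unfolding c by (intro linear_coxeter_elt lin' plus_AB_subset)
  \<comment> \<open>The index \<open>m\<close> lies in exactly one half of the bipartition, so
    \<open>e n\<close> is negated exactly once. The even power \<open>2 * m\<close> of
    \<open>c\<close> therefore fixes it.\<close>
  have c_last: "c (e n) = - e n"
  proof -
    have fixed: "s' j (e n) = e n" if "j \<in> {1..<m}" for j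
      using s'_j[of n j] that m by (simp add: Transposition.transpose_def)
    have neg: "s' m (e n) = - e n"
      using s'_m[of n] m by simp
    have one: "refl_prod s' J (e n) = (if m \<in> J then - e n else e n)" if J: "J \<subseteq> {1..m}" for J
    proof -
      have fin: "finite J" using J by (rule finite_subset) simp
      have others: "s' j (e n) = e n" if "j \<in> J" "j \<noteq> m" for j
      proof -
        have "j \<in> {1..m}" using J that(1) by blast
        then show ?thesis using that(2) by (intro fixed) auto
      qed
      show ?thesis
      proof (cases "m \<in> J")
        case True
        then have "refl_prod s' J (e n) = - e n"
          by (rule refl_prod_single[OF fin]) (simp_all add: neg others linear_neg[OF lin'])
        then show ?thesis using True by simp
      next
        case False
        then have "refl_prod s' J (e n) = e n"
          by (intro refl_prod_fixed[OF fin] others) auto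
        then show ?thesis using False by simp
      qed
    qed
    have "linear (refl_prod s' ({1..m} - plus_AB m))"
      by (intro linear_refl_prod lin') simp
    then show ?thesis
      unfolding c coxeter_elt_def
      using one[OF plus_AB_subset] one[of "{1..m} - plus_AB m"] m
      by (auto simp: linear_neg)
  qed
  have "(c ^^ (2 * k)) (e n) = e n" for k
    by (induction k) (simp_all add: c_last linear_neg[OF lin_c])
  moreover have "(c ^^ (2 * m)) (e i) = e i" if "i \<in> {1..m}" for i
  proof -
    have "(c ^^ (2 * m)) (signed_basis e m i) = signed_basis e m i"
      using that by (subst funpow_f_eq_iff) auto
    then show ?thesis
      using that by (simp add: signed_basis_def)
  qed
  ultimately have "(c ^^ (2 * m)) (e i) = id (e i)" if "i \<in> {1..n}" for i
    using that m(3) by (cases "i = n") auto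
  then have "c ^^ (2 * m) = id"
    by (intro linear_eq_std_basis[OF e linear_funpow[OF lin_c] linear_id])
  then have "coxeter_number ?s n (plus_D n) = 2 * m"
    unfolding coxeter_number_def c_def[symmetric] by (rule Least_funpow_eq_id)
  then show "coxeter_number ?s n (plus_D n) = 2 * n - 2"
    by (simp add: m(3))
  show "group_orbit ?s n (e 1) = e ` {1..n} \<union> (\<lambda>i. - e i) ` {1..n}"
    by (rule group_orbit_signed_permutations[where l = m]) (use m lin s s_last in auto)
  have span: "P = span {?u, ?v}"
    unfolding m_def by (rule coxeter_plane_D[OF n e P])
  then have "regular_polygon P (2 * m) (orth_proj P ` (e ` {1..m} \<union> (\<lambda>i. - e i) ` {1..m}))"
    using regular_polygon_image by (simp only: signed_basis_image)
  then show "regular_polygon P (2 * n - 2) (orth_proj P ` (e ` {1..n - 1} \<union> (\<lambda>i. - e i) ` {1..n - 1}))"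
    by (simp add: m(3))
  have "?u \<bullet> e n = 0" "?v \<bullet> e n = 0"
    using m by (simp_all add: cos_vec_inner[OF e] sin_vec_inner[OF e])
  then show "orth_proj P (e n) = 0" "orth_proj P (- e n) = 0"
    by (simp_all add: span orth_proj_span_pair[OF uv R])
qed

theorem mainTheorem8:
  fixes n :: nat
    and eA :: "nat \<Rightarrow> 'a::euclidean_space"
    and eB :: "nat \<Rightarrow> 'b::euclidean_space"
    and eD :: "nat \<Rightarrow> 'd::euclidean_space"
  shows
    "(\<forall>s V c h P.
        n \<ge> 2 \<and> std_basis eA (n + 1) \<and>
        s = simple_refl_A eA n \<and> V = sum_zero eA n \<and>
        c = coxeter_elt s n (plus_AB n) \<and> h = coxeter_number s n (plus_AB n) \<and>
        is_coxeter_plane V n s (plus_AB n) P \<longrightarrow>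
          group_orbit s n (eA 1) = eA ` {1..n + 1} \<and>
          h = n + 1 \<and>
          regular_polygon P h (orth_proj P ` eA ` {1..n + 1}) \<and>
          cyclic_on c (eA ` {1..n + 1}) \<and>
          (\<forall>i\<in>{1..n + 1}. regular_polygon_seq P h (\<lambda>k. orth_proj P ((c ^^ k) (eA i)))))
     \<and>
     (\<forall>s h P.
        n \<ge> 2 \<and> std_basis eB n \<and>
        s = simple_refl_B eB n \<and> h = coxeter_number s n (plus_AB n) \<and>
        is_coxeter_plane UNIV n s (plus_AB n) P \<longrightarrow>
          group_orbit s n (eB 1) = eB ` {1..n} \<union> (\<lambda>i. - eB i) ` {1..n} \<and>
          h = 2 * n \<and>
          regular_polygon P h (orth_proj P ` (eB ` {1..n} \<union> (\<lambda>i. - eB i) ` {1..n})))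
     \<and>
     (\<forall>s h P.
        n \<ge> 4 \<and> std_basis eD n \<and>
        s = simple_refl_D eD n \<and> h = coxeter_number s n (plus_D n) \<and>
        is_coxeter_plane UNIV n s (plus_D n) P \<longrightarrow>
          group_orbit s n (eD 1) = eD ` {1..n} \<union> (\<lambda>i. - eD i) ` {1..n} \<and>
          orth_proj P (eD n) = 0 \<and> orth_proj P (- eD n) = 0 \<and>
          h = 2 * n - 2 \<and>
          regular_polygon P h
            (orth_proj P ` (eD ` {1..n - 1} \<union> (\<lambda>i. - eD i) ` {1..n - 1})))"
proof ((intro conjI; intro allI impI; elim conjE), goal_cases)
  case (1 s V c h P)
  note polygon = regular_polygon_A[OF 1(1,2) 1(7)[unfolded 1(3,4)]]
  show ?case
    unfolding 1(3-6) polygon(2) using polygon by blast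
next
  case (2 s h P)
  note polygon = regular_polygon_B[OF 2(1,2) 2(5)[unfolded 2(3)]]
  show ?case
    unfolding 2(3,4) polygon(2) using polygon by blast
next
  case (3 s h P)
  note polygon = regular_polygon_D[OF 3(1,2) 3(5)[unfolded 3(3)]]
  show ?case
    unfolding 3(3,4) polygon(4) using polygon by blast
qed

end
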